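(* Let $H$ be a graph. Then List $H$-Coloring parameterized by the size $k$ of a vertex cover of the input graph admits a kernel with $\mathcal{O}(k^{c^*(H)})$ vertices and edges.
   Context: Graphs may have loops; $N(v)$ is the set of neighbors of $v$ (so $v\in N(v)$ iff $v$ has a loop). For graphs $G,H$ and lists $\mathcal{L}\colon V(G)\to 2^{V(H)}$, a list homomorphism $(G,\mathcal{L})\to H$ is a map $\varphi\colon V(G)\to V(H)$ with $\varphi(u)\varphi(v)\in E(H)$ for every $uv\in E(G)$ and $\varphi(v)\in\mathcal{L}(v)$ for all $v$. For fixed $H$, List $H$-Coloring asks, given $(G,\mathcal{L})$, whether such a list homomorphism exists. The parameter $k$ is the size of a vertex cover $X$ of $G$ (given with the input). A kernel with $f(k)$ vertices and edges is a polynomial-time algorithm that maps an instance to an equivalent instance of List $H$-Coloring whose graph has at most $f(k)$ vertices and edges. For $L,S\subseteq V(H)$, $S$ has a common neighbor in $L$ if some vertex of $L$ is adjacent to every vertex of $S$. Define $c^*(H)$ as the maximum, over all $L\subseteq V(H)$, of the largest size of an inclusion-minimal set $S\subseteq V(H)$ that has no common neighbor in $L$. *)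

theory Defs
  imports
    "HOL-Computational_Algebra.Polynomial"
    "HOL-Library.Landau_Symbols"
begin

section \<open>Finite undirected graphs, loops allowed\<close>

text \<open>An edge is the set of its endpoints, so a loop at \<open>v\<close> is the singleton
  \<open>{v} = {v, v}\<close> and \<open>card (edges G)\<close> counts every edge once.\<close>

record 'a graph =
  verts :: "'a set"
  edges :: "'a set set"

definition graph :: "'a graph \<Rightarrow> bool" where
  "graph G \<longleftrightarrow> finite (verts G) \<and> edges G \<subseteq> {{u, v} | u v. u \<in> verts G \<and> v \<in> verts G}"

definition adjacent :: "'a graph \<Rightarrow> 'a \<Rightarrow> 'a \<Rightarrow> bool" where
  "adjacent G u v \<longleftrightarrow> {u, v} \<in> edges G"

definition vertex_cover :: "'a graph \<Rightarrow> 'a set \<Rightarrow> bool" where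
  "vertex_cover G X \<longleftrightarrow> X \<subseteq> verts G \<and> (\<forall>e \<in> edges G. e \<inter> X \<noteq> {})"


section \<open>List homomorphisms\<close>

definition lists_for :: "'h graph \<Rightarrow> 'a graph \<Rightarrow> ('a \<Rightarrow> 'h set) \<Rightarrow> bool" where
  "lists_for H G L \<longleftrightarrow> (\<forall>v \<in> verts G. L v \<subseteq> verts H)"

text \<open>The values of \<open>\<phi>\<close> and \<open>L\<close> outside \<open>verts G\<close> are irrelevant.\<close>

definition list_hom ::
  "'h graph \<Rightarrow> 'a graph \<Rightarrow> ('a \<Rightarrow> 'h set) \<Rightarrow> ('a \<Rightarrow> 'h) \<Rightarrow> bool" where
  "list_hom H G L \<phi> \<longleftrightarrow>
     \<phi> ` verts G \<subseteq> verts H \<and>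
     (\<forall>v \<in> verts G. \<phi> v \<in> L v) \<and>
     (\<forall>u \<in> verts G. \<forall>v \<in> verts G. adjacent G u v \<longrightarrow> adjacent H (\<phi> u) (\<phi> v))"

definition list_colorable :: "'h graph \<Rightarrow> 'a graph \<Rightarrow> ('a \<Rightarrow> 'h set) \<Rightarrow> bool" where
  "list_colorable H G L \<longleftrightarrow> (\<exists>\<phi>. list_hom H G L \<phi>)"


section \<open>The parameter \<open>c\<^sup>*(H)\<close>\<close>

definition has_common_neighbor :: "'h graph \<Rightarrow> 'h set \<Rightarrow> 'h set \<Rightarrow> bool" where
  "has_common_neighbor H L S \<longleftrightarrow> (\<exists>a \<in> L. \<forall>s \<in> S. adjacent H a s)"

definition minimal_obstruction :: "'h graph \<Rightarrow> 'h set \<Rightarrow> 'h set \<Rightarrow> bool" where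
  "minimal_obstruction H L S \<longleftrightarrow>
     S \<subseteq> verts H \<and> \<not> has_common_neighbor H L S \<and>
     (\<forall>T. T \<subset> S \<longrightarrow> has_common_neighbor H L T)"

text \<open>For some \<open>L\<close> there may be no set without a common neighbor in \<open>L\<close>; such \<open>L\<close>
  contribute nothing to the maximum. The maximum is over a nonempty set, since the empty
  set is a minimal obstruction for \<open>L = {}\<close>.\<close>

definition c_star :: "'h graph \<Rightarrow> nat" where
  "c_star H = Max {card S | L S. L \<subseteq> verts H \<and> minimal_obstruction H L S}"

lemma finite_c_star_set:
  assumes "graph H"
  shows "finite {card S | L S. L \<subseteq> verts H \<and> minimal_obstruction H L S}"
proof (rule finite_subset)
  show "{card S | L S. L \<subseteq> verts H \<and> minimal_obstruction H L S} \<subseteq> card ` Pow (verts H)"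
    by (auto simp: minimal_obstruction_def)
  show "finite (card ` Pow (verts H))"
    using assms by (simp add: graph_def)
qed

lemma c_star_set_nonempty:
  "{card S | L S. L \<subseteq> verts H \<and> minimal_obstruction H L S} \<noteq> {}"
proof -
  have "minimal_obstruction H {} {}"
    by (simp add: minimal_obstruction_def has_common_neighbor_def)
  then show ?thesis by blast
qed


section \<open>Polynomial-time computation\<close>

text \<open>The model of computation is the WHILE language of N. Jones: imperative programs over
  variables holding binary trees. Unlike in the unit-cost version, evaluating an expression
  is charged the size of the value of every subexpression, so that no tree can be built
  without paying for all of its nodes. Running times are hence polynomially related to those
  of multitape Turing machines, also for computing functions with tree-valued results.\<close>

datatype tree = Leaf | Node tree tree

type_synonym store = "nat \<Rightarrow> tree"

datatype expr = Var nat | Nil_e | Cons_e expr expr | Hd expr | Tl expr | Eq expr expr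

fun hd_tree :: "tree \<Rightarrow> tree" where
  "hd_tree Leaf = Leaf"
| "hd_tree (Node l r) = l"

fun tl_tree :: "tree \<Rightarrow> tree" where
  "tl_tree Leaf = Leaf"
| "tl_tree (Node l r) = r"

fun tree_of_bool :: "bool \<Rightarrow> tree" where
  "tree_of_bool False = Leaf"
| "tree_of_bool True = Node Leaf Leaf"

fun val :: "expr \<Rightarrow> store \<Rightarrow> tree" where
  "val (Var x) s = s x"
| "val Nil_e s = Leaf"
| "val (Cons_e e1 e2) s = Node (val e1 s) (val e2 s)"
| "val (Hd e) s = hd_tree (val e s)"
| "val (Tl e) s = tl_tree (val e s)"
| "val (Eq e1 e2) s = tree_of_bool (val e1 s = val e2 s)"

text \<open>Here \<open>size\<close> is the number of inner nodes of a tree.\<close>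

fun cost :: "expr \<Rightarrow> store \<Rightarrow> nat" where
  "cost (Var x) s = Suc (size (s x))"
| "cost Nil_e s = 1"
| "cost (Cons_e e1 e2) s = cost e1 s + cost e2 s + Suc (size (val (Cons_e e1 e2) s))"
| "cost (Hd e) s = cost e s + Suc (size (val (Hd e) s))"
| "cost (Tl e) s = cost e s + Suc (size (val (Tl e) s))"
| "cost (Eq e1 e2) s = cost e1 s + cost e2 s + Suc (size (val (Eq e1 e2) s))"

datatype com =
    Skip
  | Assign nat expr
  | Seq com com
  | If expr com com
  | While expr com

text \<open>\<open>exec c s t s'\<close>: started in store \<open>s\<close>, program \<open>c\<close> halts after time \<open>t\<close> in store \<open>s'\<close>.
  The tree \<open>Leaf\<close> means false and every other tree means true.\<close>

inductive exec :: "com \<Rightarrow> store \<Rightarrow> nat \<Rightarrow> store \<Rightarrow> bool" where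
  Skip: "exec Skip s 1 s"
| Assign: "exec (Assign x e) s (Suc (cost e s)) (s(x := val e s))"
| Seq: "exec c1 s t1 s1 \<Longrightarrow> exec c2 s1 t2 s2 \<Longrightarrow> exec (Seq c1 c2) s (Suc (t1 + t2)) s2"
| IfTrue: "val e s \<noteq> Leaf \<Longrightarrow> exec c1 s t s' \<Longrightarrow> exec (If e c1 c2) s (Suc (cost e s + t)) s'"
| IfFalse: "val e s = Leaf \<Longrightarrow> exec c2 s t s' \<Longrightarrow> exec (If e c1 c2) s (Suc (cost e s + t)) s'"
| WhileFalse: "val e s = Leaf \<Longrightarrow> exec (While e c) s (Suc (cost e s)) s"
| WhileTrue: "val e s \<noteq> Leaf \<Longrightarrow> exec c s t1 s1 \<Longrightarrow> exec (While e c) s1 t2 s2 \<Longrightarrow>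
    exec (While e c) s (Suc (cost e s + t1 + t2)) s2"

lemma exec_deterministic:
  "exec c s t s' \<Longrightarrow> exec c s u s'' \<Longrightarrow> u = t \<and> s'' = s'"
proof (induction arbitrary: u s'' rule: exec.induct)
  case (Seq c1 s t1 s1 c2 t2 s2)
  from Seq.prems show ?case by (cases rule: exec.cases) (use Seq.IH in blast)+
next
  case (IfTrue e s c1 t s' c2)
  from IfTrue.prems show ?case by (cases rule: exec.cases) (use IfTrue in blast)+
next
  case (IfFalse e s c2 t s' c1)
  from IfFalse.prems show ?case by (cases rule: exec.cases) (use IfFalse in blast)+
next
  case (WhileTrue e s c t1 s1 t2 s2)
  from WhileTrue.prems show ?case by (cases rule: exec.cases) (use WhileTrue in blast)+
qed (auto elim: exec.cases)

text \<open>Variable \<open>0\<close> holds the input and, at the end, the output; the others start as \<open>Leaf\<close>.\<close>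

definition computes_within :: "com \<Rightarrow> tree \<Rightarrow> tree \<Rightarrow> nat \<Rightarrow> bool" where
  "computes_within c x y b \<longleftrightarrow>
     (\<exists>t s. exec c ((\<lambda>_. Leaf)(0 := x)) t s \<and> s 0 = y \<and> t \<le> b)"

definition polynomial_time_on :: "tree set \<Rightarrow> (tree \<Rightarrow> tree) \<Rightarrow> bool" where
  "polynomial_time_on A f \<longleftrightarrow>
     (\<exists>c (p :: nat poly). \<forall>x \<in> A. computes_within c x (f x) (poly p (size x)))"


section \<open>Instances and their encoding\<close>

text \<open>Input and output graphs of algorithms have a vertex set of the form \<open>{..<n}\<close>,
  and are stored as adjacency matrices. The encoding has length polynomial in \<open>n\<close>.\<close>

definition list_coloring_instance ::
  "'h graph \<Rightarrow> nat graph \<Rightarrow> (nat \<Rightarrow> 'h set) \<Rightarrow> bool" where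
  "list_coloring_instance H G L \<longleftrightarrow>
     graph G \<and> (\<exists>n. verts G = {..<n}) \<and> lists_for H G L"

fun tree_of_list :: "tree list \<Rightarrow> tree" where
  "tree_of_list [] = Leaf"
| "tree_of_list (x # xs) = Node x (tree_of_list xs)"

definition tree_of_bits :: "bool list \<Rightarrow> tree" where
  "tree_of_bits bs = tree_of_list (map tree_of_bool bs)"

definition vertex_list :: "nat graph \<Rightarrow> nat list" where
  "vertex_list G = [0..<card (verts G)]"

definition encode_graph :: "nat graph \<Rightarrow> tree" where
  "encode_graph G =
     tree_of_list (map (\<lambda>u. tree_of_bits (map (adjacent G u) (vertex_list G))) (vertex_list G))"

text \<open>\<open>hs\<close> lists the vertices of the fixed graph \<open>H\<close>; a set of colors is stored as its
  characteristic vector with respect to \<open>hs\<close>.\<close>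

definition encode_lists :: "'h list \<Rightarrow> nat graph \<Rightarrow> (nat \<Rightarrow> 'h set) \<Rightarrow> tree" where
  "encode_lists hs G L =
     tree_of_list (map (\<lambda>v. tree_of_bits (map (\<lambda>a. a \<in> L v) hs)) (vertex_list G))"

definition encode_instance :: "'h list \<Rightarrow> nat graph \<Rightarrow> (nat \<Rightarrow> 'h set) \<Rightarrow> tree" where
  "encode_instance hs G L = Node (encode_graph G) (encode_lists hs G L)"

definition encode_vc_instance ::
  "'h list \<Rightarrow> nat graph \<Rightarrow> (nat \<Rightarrow> 'h set) \<Rightarrow> nat set \<Rightarrow> tree" where
  "encode_vc_instance hs G L X =
     Node (encode_instance hs G L) (tree_of_bits (map (\<lambda>v. v \<in> X) (vertex_list G)))"


section \<open>Kernels\<close>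

definition kernelization ::
  "'h graph \<Rightarrow> 'h list \<Rightarrow> (nat \<Rightarrow> nat) \<Rightarrow> (tree \<Rightarrow> tree) \<Rightarrow> bool" where
  "kernelization H hs f K \<longleftrightarrow>
     polynomial_time_on
       {encode_vc_instance hs G L X | G L X. list_coloring_instance H G L \<and> vertex_cover G X} K \<and>
     (\<forall>G L X. list_coloring_instance H G L \<and> vertex_cover G X \<longrightarrow>
        (\<exists>G' L'. list_coloring_instance H G' L' \<and>
           K (encode_vc_instance hs G L X) = encode_instance hs G' L' \<and>
           (list_colorable H G' L' \<longleftrightarrow> list_colorable H G L) \<and>
           card (verts G') \<le> f (card X) \<and>
           card (edges G') \<le> f (card X)))"

text \<open>The choice of the enumeration \<open>hs\<close> of the colors is immaterial, so all are admitted.\<close>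

definition admits_kernel :: "'h graph \<Rightarrow> (nat \<Rightarrow> nat) \<Rightarrow> bool" where
  "admits_kernel H f \<longleftrightarrow>
     (\<forall>hs. distinct hs \<and> set hs = verts H \<longrightarrow> (\<exists>K. kernelization H hs f K))"

end

theory Submission
  imports Defs
begin

text \<open>If \<open>c_star H \<le> 1\<close>, the neighborhoods of the vertices of \<open>H\<close> form a chain, so coloring
  every vertex with the color of its list that has the largest neighborhood is optimal, and the
  instance can be solved edge by edge. Otherwise, a coloring of the vertex cover \<open>X\<close> extends to
  \<open>v \<notin> X\<close> unless the colors of some at most \<open>c_star H\<close> neighbors of \<open>v\<close> form a minimal
  obstruction for \<open>L v\<close>. So the vertices outside \<open>X\<close> may be replaced by one vertex with list \<open>l\<close>
  and neighborhood \<open>t\<close> for every list \<open>l\<close> and every sequence \<open>t\<close> in \<open>X\<close> of length at most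
  \<open>c_star H\<close> for which some vertex outside \<open>X\<close> with list \<open>l\<close> is adjacent to all of \<open>t\<close>.

  That this is computable in polynomial time follows from closure properties of polynomial-time
  functions, the main one being that they are closed under folding over a list as long as the
  intermediate results remain polynomially bounded.\<close>

section \<open>Trees as lists\<close>

text \<open>The bound \<open>c_star H\<close> counts colors, whereas \<open>t\<close> must be a
  sequence of vertices of \<open>X\<close>. A minimal obstruction among the colors around
  \<open>v\<close> is lifted by choosing one neighbor of \<open>v\<close> per color, so the number
  of vertices does not exceed the number of colors, however large the degree of \<open>v\<close>.
  Which neighbors are chosen depends on the coloring of \<open>X\<close>, which is unknown; hence
  every short sequence has to be present. In the other direction, a new vertex keeps only part of
  the constraints of some \<open>v\<close> with the same list and can copy the color of
  \<open>v\<close>.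

  As \<open>H\<close> is fixed, there are only \<open>2 ^ card (verts H)\<close> possible lists, a
  constant, and each new vertex brings at most \<open>c_star H\<close> edges. The edges inside
  \<open>X\<close>, however, are kept, and there may be quadratically many of them. This fits the
  bound only if \<open>c_star H\<close> is at least 2, which forces the separate treatment of the
  remaining \<open>H\<close>; there the kernel has constant size.\<close>

fun list_of_tree :: "tree \<Rightarrow> tree list" where
  "list_of_tree Leaf = []"
| "list_of_tree (Node x t) = x # list_of_tree t"

lemma list_of_tree_of_list [simp]: "list_of_tree (tree_of_list xs) = xs"
  by (induction xs) auto

lemma tree_of_list_of_tree [simp]: "tree_of_list (list_of_tree t) = t"
  by (induction t) auto

lemma tree_of_list_eq_iff [simp]: "tree_of_list xs = tree_of_list ys \<longleftrightarrow> xs = ys"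
  by (metis list_of_tree_of_list)

lemma size_tree_of_list: "size (tree_of_list xs) = sum_list (map size xs) + length xs"
  by (induction xs) auto

lemma size_le_size_tree_of_list: "y \<in> set xs \<Longrightarrow> size y \<le> size (tree_of_list xs)"
  by (induction xs) auto

lemma length_le_size_tree_of_list: "length xs \<le> size (tree_of_list xs)"
  by (simp add: size_tree_of_list)

lemma tree_of_bool_eq_Leaf [simp]: "tree_of_bool b = Leaf \<longleftrightarrow> \<not> b"
  by (cases b) auto

lemma tree_of_bool_eq_iff [simp]: "tree_of_bool a = tree_of_bool b \<longleftrightarrow> a = b"
  by (cases a; cases b) auto

lemma size_tree_of_bool_le: "size (tree_of_bool b) \<le> 1"
  by (cases b) auto

lemma size_tl_tree_le: "size (tl_tree t) \<le> size t"
  by (cases t) auto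


section \<open>Polynomially bounded functions\<close>

definition poly_bounded :: "(tree \<Rightarrow> nat) \<Rightarrow> bool" where
  "poly_bounded b \<longleftrightarrow> (\<exists>p :: nat poly. \<forall>x. b x \<le> poly p (size x))"

text \<open>Coefficients are natural numbers, so no term can decrease. This lets size estimates pass
  through polynomial time bounds.\<close>

lemma poly_nat_mono: "m \<le> n \<Longrightarrow> poly p m \<le> poly p n" for p :: "nat poly"
proof (induction p)
  case (pCons a p)
  then show ?case by (simp add: mult_le_mono)
qed simp

lemma poly_bounded_le: "poly_bounded b \<Longrightarrow> (\<And>x. a x \<le> b x) \<Longrightarrow> poly_bounded a"
  unfolding poly_bounded_def by (meson order_trans)

lemma poly_bounded_const: "poly_bounded (\<lambda>_. n)"
  unfolding poly_bounded_def by (rule exI[of _ "[:n:]"]) simp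

lemma poly_bounded_size: "poly_bounded size"
  unfolding poly_bounded_def by (rule exI[of _ "[:0, 1:]"]) simp

lemma poly_bounded_add:
  assumes "poly_bounded a" "poly_bounded b"
  shows "poly_bounded (\<lambda>x. a x + b x)"
proof -
  obtain p q where "\<forall>x. a x \<le> poly p (size x)" "\<forall>x. b x \<le> poly q (size x)"
    using assms unfolding poly_bounded_def by blast
  then have "\<forall>x. a x + b x \<le> poly (p + q) (size x)" by (simp add: add_mono)
  then show ?thesis unfolding poly_bounded_def by blast
qed

lemma poly_bounded_mult:
  assumes "poly_bounded a" "poly_bounded b"
  shows "poly_bounded (\<lambda>x. a x * b x)"
proof -
  obtain p q where "\<forall>x. a x \<le> poly p (size x)" "\<forall>x. b x \<le> poly q (size x)"
    using assms unfolding poly_bounded_def by blast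
  then have "\<forall>x. a x * b x \<le> poly (p * q) (size x)" by (simp add: mult_le_mono)
  then show ?thesis unfolding poly_bounded_def by blast
qed

lemma poly_bounded_poly:
  assumes "poly_bounded a"
  shows "poly_bounded (\<lambda>x. poly p (a x))"
proof -
  obtain q where "\<forall>x. a x \<le> poly q (size x)"
    using assms unfolding poly_bounded_def by blast
  then have "\<forall>x. poly p (a x) \<le> poly (pcompose p q) (size x)"
    by (simp add: poly_pcompose poly_nat_mono)
  then show ?thesis unfolding poly_bounded_def by blast
qed

lemma poly_bounded_comp:
  assumes "poly_bounded T" "poly_bounded (\<lambda>x. size (f x))"
  shows "poly_bounded (\<lambda>x. T (f x))"
proof -
  obtain p where "\<forall>x. T x \<le> poly p (size x)"
    using assms(1) unfolding poly_bounded_def by blast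
  then show ?thesis
    using poly_bounded_le[OF poly_bounded_poly[OF assms(2), of p], of "\<lambda>x. T (f x)"] by blast
qed

lemma poly_bounded_Suc: "poly_bounded a \<Longrightarrow> poly_bounded (\<lambda>x. Suc (a x))"
  using poly_bounded_add[OF _ poly_bounded_const[of 1]] by simp

lemmas poly_bounded_intros =
  poly_bounded_const poly_bounded_size poly_bounded_Suc poly_bounded_add poly_bounded_mult poly_bounded_poly


section \<open>Polynomial-time functions\<close>

lemma size_val_le_cost: "size (val e s) \<le> cost e s"
  by (cases e) auto

text \<open>Every expression costs at least the size of its value, so a variable cannot grow by more
  than the time spent.\<close>

lemma exec_size_le: "exec c s t s' \<Longrightarrow> size (s' i) \<le> size (s i) + t"
proof (induction rule: exec.induct)
  case (Assign x e s)
  then show ?case using size_val_le_cost[of e s] by auto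
qed auto

text \<open>As nothing is assumed about the variables above \<open>d\<close> and those below are preserved, programs
  can be nested without interference.\<close>

definition computes_at :: "com \<Rightarrow> nat \<Rightarrow> nat \<Rightarrow> (tree \<Rightarrow> tree) \<Rightarrow> (tree \<Rightarrow> nat) \<Rightarrow> bool" where
  "computes_at c b d f T \<longleftrightarrow>
     (\<forall>s. \<exists>t s'. exec c s t s' \<and> s' d = f (s b) \<and> (\<forall>i<d. s' i = s i) \<and> t \<le> T (s b))"

lemma computes_atI:
  assumes "\<And>s. \<exists>t s'. exec c s t s' \<and> s' d = f (s b) \<and> (\<forall>i<d. s' i = s i) \<and> t \<le> T (s b)"
  shows "computes_at c b d f T"
  using assms by (simp add: computes_at_def)

lemma computes_atE:
  assumes "computes_at c b d f T"
  obtains t s' where "exec c s t s'" "s' d = f (s b)" "\<forall>i<d. s' i = s i" "t \<le> T (s b)"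
  using assms unfolding computes_at_def by blast

text \<open>The base \<open>b\<close> is arbitrary so that a program can be placed above all
  variables that are still needed. The function is computed on all trees, not only on encodings,
  which frees the closure properties from domain conditions.\<close>

definition poly_time :: "(tree \<Rightarrow> tree) \<Rightarrow> bool" where
  "poly_time f \<longleftrightarrow> (\<forall>b. \<exists>c T. poly_bounded T \<and> computes_at c b b f T)"

lemma poly_timeI:
  assumes "\<And>b. \<exists>c. computes_at c b b f T" "poly_bounded T"
  shows "poly_time f"
  using assms unfolding poly_time_def by blast

lemma poly_timeE:
  assumes "poly_time f"
  obtains c T where "poly_bounded T" "computes_at c b b f T"
  using assms unfolding poly_time_def by blast

lemma poly_time_imp_polynomial_time_on:
  assumes "poly_time f"
  shows "polynomial_time_on A f"
proof -
  obtain c T where T: "poly_bounded T" and c: "computes_at c 0 0 f T"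
    using poly_timeE[OF assms] .
  obtain p where p: "\<forall>x. T x \<le> poly p (size x)"
    using T unfolding poly_bounded_def by blast
  have "computes_within c x (f x) (poly p (size x))" for x
  proof -
    obtain t s' where "exec c ((\<lambda>_. Leaf)(0 := x)) t s'" "s' 0 = f x" "t \<le> T x"
      by (rule computes_atE[OF c, of "(\<lambda>_. Leaf)(0 := x)"]) auto
    then show ?thesis
      using p unfolding computes_within_def by (meson le_trans)
  qed
  then show ?thesis unfolding polynomial_time_on_def by blast
qed

text \<open>Time bounds output size. This is what makes composition work: the second program is fed
  an input of polynomial size.\<close>

lemma poly_time_size:
  assumes "poly_time f"
  shows "poly_bounded (\<lambda>x. size (f x))"
proof -
  obtain c T where T: "poly_bounded T" and c: "computes_at c 0 0 f T"
    using poly_timeE[OF assms] .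
  have "size (f x) \<le> size x + T x" for x
  proof -
    obtain t s' where 1: "exec c (\<lambda>_. x) t s'" "s' 0 = f x" "t \<le> T x"
      by (rule computes_atE[OF c, of "\<lambda>_. x"])
    show ?thesis using exec_size_le[OF 1(1), of 0] 1 by simp
  qed
  then show ?thesis
    using poly_bounded_le[OF poly_bounded_add[OF poly_bounded_size T], of "\<lambda>x. size (f x)"]
    by blast
qed

section \<open>Elementary polynomial-time functions\<close>

lemma poly_time_assign:
  assumes "\<And>b s. val (e b) s = f (s b)" "\<And>b s. cost (e b) s \<le> T (s b)" "poly_bounded T"
  shows "poly_time f"
proof (rule poly_timeI)
  show "\<exists>c. computes_at c b b f (\<lambda>x. T x + 1)" for b
  proof (intro exI computes_atI conjI)
    show "exec (Assign b (e b)) s (Suc (cost (e b) s)) (s(b := val (e b) s))" for s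
      by (rule exec.Assign)
  qed (use assms in auto)
  show "poly_bounded (\<lambda>x. T x + 1)"
    by (intro poly_bounded_intros assms)
qed

lemma poly_time_id: "poly_time (\<lambda>x. x)"
  by (rule poly_time_assign[where e = Var and T = "\<lambda>x. size x + 1"])
    (auto intro: poly_bounded_intros)

lemma poly_time_hd_tree: "poly_time hd_tree"
proof (rule poly_time_assign[where e = "\<lambda>b. Hd (Var b)" and T = "\<lambda>x. size x + size x + 2"])
  show "cost (Hd (Var b)) s \<le> size (s b) + size (s b) + 2" for b s
    by (cases "s b") auto
qed (simp, intro poly_bounded_intros)

lemma poly_time_tl_tree: "poly_time tl_tree"
proof (rule poly_time_assign[where e = "\<lambda>b. Tl (Var b)" and T = "\<lambda>x. size x + size x + 2"])
  show "cost (Tl (Var b)) s \<le> size (s b) + size (s b) + 2" for b s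
    by (cases "s b") auto
qed (simp, intro poly_bounded_intros)

lemma poly_time_eq_components: "poly_time (\<lambda>x. tree_of_bool (hd_tree x = tl_tree x))"
proof (rule poly_time_assign[where e = "\<lambda>b. Eq (Hd (Var b)) (Tl (Var b))" and
      T = "\<lambda>x. size x + size x + size x + 6"])
  show "cost (Eq (Hd (Var b)) (Tl (Var b))) s \<le> size (s b) + size (s b) + size (s b) + 6" for b s
    using size_tree_of_bool_le[of "hd_tree (s b) = tl_tree (s b)"] by (cases "s b") auto
qed (simp, intro poly_bounded_intros)

primrec expr_of_tree :: "tree \<Rightarrow> expr" where
  "expr_of_tree Leaf = Nil_e"
| "expr_of_tree (Node l r) = Cons_e (expr_of_tree l) (expr_of_tree r)"

lemma val_expr_of_tree [simp]: "val (expr_of_tree t) s = t"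
  by (induction t) auto

text \<open>The bound is quadratic because every subexpression is charged the size of its whole
  value.\<close>

lemma cost_expr_of_tree: "cost (expr_of_tree t) s \<le> 2 * (size t + 1) * (size t + 1)"
proof (induction t)
  case (Node l r)
  then show ?case by (simp add: algebra_simps)
qed simp

lemma poly_time_const: "poly_time (\<lambda>_. t)"
  by (rule poly_time_assign[where e = "\<lambda>_. expr_of_tree t" and
        T = "\<lambda>_. 2 * (size t + 1) * (size t + 1)"])
    (simp_all only: val_expr_of_tree cost_expr_of_tree poly_bounded_const)

section \<open>Composition, pairing and branching\<close>

lemma poly_time_comp:
  assumes "poly_time g" "poly_time f"
  shows "poly_time (\<lambda>x. g (f x))"
  unfolding poly_time_def
proof
  fix b
  obtain c T where T: "poly_bounded T" and c: "computes_at c b b f T"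
    using poly_timeE[OF assms(2)] .
  obtain d U where U: "poly_bounded U" and d: "computes_at d b b g U"
    using poly_timeE[OF assms(1)] .
  have "computes_at (Seq c d) b b (\<lambda>x. g (f x)) (\<lambda>x. T x + U (f x) + 1)"
  proof (rule computes_atI)
    fix s :: store
    obtain t1 s1 where 1: "exec c s t1 s1" "s1 b = f (s b)" "\<forall>i<b. s1 i = s i" "t1 \<le> T (s b)"
      using computes_atE[OF c, where s = s] .
    obtain t2 s2 where 2: "exec d s1 t2 s2" "s2 b = g (s1 b)" "\<forall>i<b. s2 i = s1 i" "t2 \<le> U (s1 b)"
      using computes_atE[OF d, where s = s1] .
    show "\<exists>t s'. exec (Seq c d) s t s' \<and> s' b = g (f (s b)) \<and> (\<forall>i<b. s' i = s i) \<and>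
        t \<le> T (s b) + U (f (s b)) + 1"
      by (intro exI conjI, rule exec.Seq[OF 1(1) 2(1)]) (use 1 2 in auto)
  qed
  moreover have "poly_bounded (\<lambda>x. T x + U (f x) + 1)"
    by (intro poly_bounded_intros T poly_bounded_comp[OF U] poly_time_size assms)
  ultimately show "\<exists>c T. poly_bounded T \<and> computes_at c b b (\<lambda>x. g (f x)) T"
    by blast
qed

text \<open>The input is copied to \<open>d\<close> first. For \<open>b < d\<close> the original
  survives, so several functions can be applied to the same input.\<close>

lemma poly_time_fresh:
  assumes "poly_time f"
  obtains c T where "poly_bounded T" "computes_at c b d f T"
proof -
  obtain c T where T: "poly_bounded T" and c: "computes_at c d d f T"
    using poly_timeE[OF assms] .
  have "computes_at (Seq (Assign d (Var b)) c) b d f (\<lambda>x. T x + size x + 3)"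
  proof (rule computes_atI)
    fix s :: store
    let ?s1 = "s(d := s b)"
    have 1: "exec (Assign d (Var b)) s (size (s b) + 2) ?s1"
      using exec.Assign[of d "Var b" s] by simp
    obtain t2 s2 where 2: "exec c ?s1 t2 s2" "s2 d = f (?s1 d)" "\<forall>i<d. s2 i = ?s1 i"
      "t2 \<le> T (?s1 d)"
      using computes_atE[OF c, where s = ?s1] .
    show "\<exists>t s'. exec (Seq (Assign d (Var b)) c) s t s' \<and> s' d = f (s b) \<and> (\<forall>i<d. s' i = s i) \<and>
        t \<le> T (s b) + size (s b) + 3"
      by (intro exI conjI, rule exec.Seq[OF 1 2(1)]) (use 2 in auto)
  qed
  moreover have "poly_bounded (\<lambda>x. T x + size x + 3)"
    by (intro poly_bounded_intros T)
  ultimately show ?thesis using that by blast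
qed

lemma poly_time_Node:
  assumes "poly_time f" "poly_time g"
  shows "poly_time (\<lambda>x. Node (f x) (g x))"
  unfolding poly_time_def
proof
  fix b :: nat
  \<comment> \<open>The program for \<open>g\<close> works at \<open>b+2\<close> and preserves
    everything below, hence both the input at \<open>b\<close> and the value of \<open>f\<close> at
    \<open>b+1\<close>.\<close>
  obtain c T where T: "poly_bounded T" and c: "computes_at c b (b+1) f T"
    using poly_time_fresh[OF assms(1)] .
  obtain d U where U: "poly_bounded U" and d: "computes_at d b (b+2) g U"
    using poly_time_fresh[OF assms(2)] .
  let ?e = "Cons_e (Var (b+1)) (Var (b+2))"
  let ?T = "\<lambda>x. T x + U x + 2 * size (f x) + 2 * size (g x) + 10"
  have "computes_at (Seq c (Seq d (Assign b ?e))) b b (\<lambda>x. Node (f x) (g x)) ?T"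
  proof (rule computes_atI)
    fix s :: store
    obtain t1 s1 where 1: "exec c s t1 s1" "s1 (b+1) = f (s b)" "\<forall>i<b+1. s1 i = s i"
      "t1 \<le> T (s b)"
      using computes_atE[OF c, where s = s] .
    obtain t2 s2 where 2: "exec d s1 t2 s2" "s2 (b+2) = g (s1 b)" "\<forall>i<b+2. s2 i = s1 i"
      "t2 \<le> U (s1 b)"
      using computes_atE[OF d, where s = s1] .
    have "s1 b = s b" "s2 (b+1) = f (s b)" "\<forall>i<b. s2 i = s i"
      using 1 2 by auto
    with 1(4) 2(2,4) show "\<exists>t s'. exec (Seq c (Seq d (Assign b ?e))) s t s' \<and>
        s' b = Node (f (s b)) (g (s b)) \<and> (\<forall>i<b. s' i = s i) \<and> t \<le> ?T (s b)"
      by - (rule exI, rule exI, rule conjI,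
        rule exec.Seq[OF 1(1) exec.Seq[OF 2(1) exec.Assign[of b ?e s2]]], auto)
  qed
  moreover have "poly_bounded ?T"
    by (intro poly_bounded_intros T U poly_time_size assms)
  ultimately show "\<exists>c T. poly_bounded T \<and> computes_at c b b (\<lambda>x. Node (f x) (g x)) T"
    by blast
qed

lemma poly_time_if_Leaf:
  assumes "poly_time h" "poly_time f" "poly_time g"
  shows "poly_time (\<lambda>x. if h x \<noteq> Leaf then f x else g x)"
  unfolding poly_time_def
proof
  fix b :: nat
  obtain a S where S: "poly_bounded S" and a: "computes_at a b (b+1) h S"
    using poly_time_fresh[OF assms(1)] .
  \<comment> \<open>The branches may work at \<open>b\<close> itself: once the test has been made,
    the value at \<open>b+1\<close> can be overwritten.\<close>
  obtain c T where T: "poly_bounded T" and c: "computes_at c b b f T"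
    using poly_timeE[OF assms(2)] .
  obtain d U where U: "poly_bounded U" and d: "computes_at d b b g U"
    using poly_timeE[OF assms(3)] .
  let ?k = "\<lambda>x. if h x \<noteq> Leaf then f x else g x"
  let ?T = "\<lambda>x. S x + T x + U x + size (h x) + 4"
  have "computes_at (Seq a (If (Var (b+1)) c d)) b b ?k ?T"
  proof (rule computes_atI)
    fix s :: store
    obtain t1 s1 where 1: "exec a s t1 s1" "s1 (b+1) = h (s b)" "\<forall>i<b+1. s1 i = s i"
      "t1 \<le> S (s b)"
      using computes_atE[OF a, where s = s] .
    show "\<exists>t s'. exec (Seq a (If (Var (b+1)) c d)) s t s' \<and> s' b = ?k (s b) \<and>
        (\<forall>i<b. s' i = s i) \<and> t \<le> ?T (s b)"
    proof (cases "h (s b) = Leaf")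
      case True
      obtain t2 s2 where 2: "exec d s1 t2 s2" "s2 b = g (s1 b)" "\<forall>i<b. s2 i = s1 i"
        "t2 \<le> U (s1 b)"
        using computes_atE[OF d, where s = s1] .
      have "exec (If (Var (b+1)) c d) s1 (Suc (cost (Var (b+1)) s1 + t2)) s2"
        using True 1 2(1) by (intro exec.IfFalse) auto
      from exec.Seq[OF 1(1) this] show ?thesis
        by (intro exI conjI) (assumption, use True 1(2-4) 2(2-4) in auto)
    next
      case False
      obtain t2 s2 where 2: "exec c s1 t2 s2" "s2 b = f (s1 b)" "\<forall>i<b. s2 i = s1 i"
        "t2 \<le> T (s1 b)"
        using computes_atE[OF c, where s = s1] .
      have "exec (If (Var (b+1)) c d) s1 (Suc (cost (Var (b+1)) s1 + t2)) s2"
        using False 1 2(1) by (intro exec.IfTrue) auto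
      from exec.Seq[OF 1(1) this] show ?thesis
        by (intro exI conjI) (assumption, use False 1(2-4) 2(2-4) in auto)
    qed
  qed
  moreover have "poly_bounded ?T"
    by (intro poly_bounded_intros S T U poly_time_size assms)
  ultimately show "\<exists>c T. poly_bounded T \<and> computes_at c b b ?k T"
    by blast
qed

text \<open>Layout: \<open>b\<close> holds the context \<open>x\<close>, \<open>b+1\<close> the rest
  of the list, \<open>b+2\<close> the accumulator, and \<open>b+3\<close> the triple on which
  \<open>c\<close> runs. \<open>Q\<close> bounds the accumulator after every prefix,
  \<open>R\<close> the remaining list, and \<open>B\<close> the time of one run of \<open>c\<close>.
  The remaining factor of the time bound pays for moving these values around.\<close>

lemma exec_fold_loop:
  fixes b :: nat and g :: "tree \<Rightarrow> tree \<Rightarrow> tree \<Rightarrow> tree"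
  defines "loop c \<equiv> While (Var (b+1))
    (Seq (Assign (b+3) (Cons_e (Var (b+2)) (Cons_e (Hd (Var (b+1))) (Var b))))
    (Seq c (Seq (Assign (b+2) (Var (b+3))) (Assign (b+1) (Tl (Var (b+1)))))))"
  assumes c: "computes_at c (b+3) (b+3)
      (\<lambda>z. g (hd_tree z) (hd_tree (tl_tree z)) (tl_tree (tl_tree z))) T"
    and T: "\<And>z. size z \<le> Q + R + size x + 2 \<Longrightarrow> T z \<le> B"
  shows "\<lbrakk>s b = x; s (b+1) = tree_of_list ys; s (b+2) = a; size (tree_of_list ys) \<le> R;
      \<And>n. size (foldl (\<lambda>a y. g a y x) a (take n ys)) \<le> Q\<rbrakk> \<Longrightarrow>
    \<exists>t s'. exec (loop c) s t s' \<and> s' (b+2) = foldl (\<lambda>a y. g a y x) a ys \<and> (\<forall>i\<le>b. s' i = s i) \<and>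
      t \<le> (length ys + 1) * (B + 10 * (Q + R + size x) + 30)"
proof (induction ys arbitrary: a s)
  case Nil
  show ?case
  proof (intro exI conjI)
    show "exec (loop c) s (Suc (cost (Var (b+1)) s)) s"
      unfolding loop_def using Nil by (intro exec.WhileFalse) simp
  qed (use Nil in auto)
next
  case (Cons y ys)
  let ?e = "Cons_e (Var (b+2)) (Cons_e (Hd (Var (b+1))) (Var b))"
  let ?z = "Node a (Node y x)"
  define s1 where "s1 = s(b+3 := ?z)"
  have 1: "exec (Assign (b+3) ?e) s (Suc (cost ?e s)) s1"
    using exec.Assign[of "b+3" ?e s] Cons.prems by (simp add: s1_def)
  obtain t2 s2 where 2: "exec c s1 t2 s2" "s2 (b+3) = g a y x" "\<forall>i<b+3. s2 i = s1 i"
    "t2 \<le> T ?z"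
    by (rule computes_atE[OF c, of s1]) (auto simp: s1_def)
  define s3 where "s3 = s2(b+2 := g a y x)"
  have 3: "exec (Assign (b+2) (Var (b+3))) s2 (Suc (cost (Var (b+3)) s2)) s3"
    using exec.Assign[of "b+2" "Var (b+3)" s2] 2 by (simp add: s3_def)
  define s4 where "s4 = s3(b+1 := tree_of_list ys)"
  have s3: "s3 (b+1) = tree_of_list (y # ys)"
    using 2 Cons.prems by (simp add: s3_def s1_def)
  have 4: "exec (Assign (b+1) (Tl (Var (b+1)))) s3 (Suc (cost (Tl (Var (b+1))) s3)) s4"
    using exec.Assign[of "b+1" "Tl (Var (b+1))" s3] s3 by (simp add: s4_def)
  note body = exec.Seq[OF 1 exec.Seq[OF 2(1) exec.Seq[OF 3 4]]]
  \<comment> \<open>Prefixes of length 0 and 1 bound the accumulator before and after this round;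
    longer ones give the hypothesis for the rest of the list.\<close>
  have a: "size a \<le> Q" using Cons.prems(5)[of 0] by simp
  have ga: "size (g a y x) \<le> Q" using Cons.prems(5)[of 1] by simp
  have "size (foldl (\<lambda>a y. g a y x) (g a y x) (take n ys)) \<le> Q" for n
    using Cons.prems(5)[of "Suc n"] by simp
  moreover have s4: "s4 b = x" "s4 (b+1) = tree_of_list ys" "s4 (b+2) = g a y x" "\<forall>i\<le>b. s4 i = s i"
    using 2 Cons.prems by (auto simp: s4_def s3_def s1_def)
  moreover have R: "size y + size (tree_of_list ys) + 1 \<le> R" using Cons.prems by simp
  ultimately obtain t5 s5 where 5: "exec (loop c) s4 t5 s5"
    "s5 (b+2) = foldl (\<lambda>a y. g a y x) (g a y x) ys" "\<forall>i\<le>b. s5 i = s4 i"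
    "t5 \<le> (length ys + 1) * (B + 10 * (Q + R + size x) + 30)"
    using Cons.IH[of s4 "g a y x"] by auto
  have "val (Var (b+1)) s \<noteq> Leaf" using Cons.prems by simp
  from exec.WhileTrue[OF this body, of t5 s5] 5(1)
  have ex: "exec (loop c) s (Suc (cost (Var (b+1)) s + (Suc (Suc (cost ?e s) + Suc (t2 +
    Suc (Suc (cost (Var (b+3)) s2) + Suc (cost (Tl (Var (b+1))) s3))))) + t5)) s5"
    unfolding loop_def by blast
  have "T ?z \<le> B" using a R by (intro T) simp
  then have t2: "t2 \<le> B" using 2 by simp
  have c1: "cost (Var (b+1)) s \<le> R + 1" using Cons.prems by simp
  have c2: "cost ?e s \<le> 2 * Q + 4 * R + 3 * size x + 10"
    using Cons.prems(1-3) a R by simp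
  have c3: "cost (Var (b+3)) s2 \<le> Q + 1" using 2 ga by simp
  have c4: "cost (Tl (Var (b+1))) s3 \<le> 2 * R + 2" using s3 R by simp
  have "Suc (cost (Var (b+1)) s + (Suc (Suc (cost ?e s) + Suc (t2 +
    Suc (Suc (cost (Var (b+3)) s2) + Suc (cost (Tl (Var (b+1))) s3))))) + t5)
    \<le> (B + 10 * (Q + R + size x) + 30) + (length ys + 1) * (B + 10 * (Q + R + size x) + 30)"
  proof -
    \<comment> \<open>With the product abstracted to \<open>M\<close>, the inequality becomes
      linear.\<close>
    define M where "M = (length ys + 1) * (B + 10 * (Q + R + size x) + 30)"
    have "t5 \<le> M" using 5(4) by (simp only: M_def)
    moreover have "Suc (k1 + (Suc (Suc k2 + Suc (t2 + Suc (Suc k3 + Suc k4)))) + t5)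
        \<le> (B + 10 * (Q + R + size x) + 30) + M"
      if "t5 \<le> M" "k1 \<le> R + 1" "k2 \<le> 2 * Q + 4 * R + 3 * size x + 10" "k3 \<le> Q + 1"
        "k4 \<le> 2 * R + 2" for k1 k2 k3 k4
      using that t2 by simp
    ultimately show ?thesis unfolding M_def[symmetric] using c1 c2 c3 c4 by blast
  qed
  also have "\<dots> = (length (y # ys) + 1) * (B + 10 * (Q + R + size x) + 30)"
    by simp
  finally have time: "Suc (cost (Var (b+1)) s + (Suc (Suc (cost ?e s) + Suc (t2 +
    Suc (Suc (cost (Var (b+3)) s2) + Suc (cost (Tl (Var (b+1))) s3))))) + t5)
    \<le> (length (y # ys) + 1) * (B + 10 * (Q + R + size x) + 30)" .
  moreover have "s5 (b+2) = foldl (\<lambda>a y. g a y x) a (y # ys)" "\<forall>i\<le>b. s5 i = s i"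
    using 5(2,3) s4(4) by auto
  ultimately show ?case using ex by blast
qed

text \<open>The bound \<open>Q\<close> on all intermediate accumulators cannot be derived from
  \<open>g\<close> being polynomial: a step that doubles its accumulator is cheap, but its iteration
  is exponential. Given \<open>Q\<close>, each round is polynomial in the original input, and there
  are at most \<open>size (l x)\<close> rounds.\<close>

lemma poly_time_foldl:
  assumes l: "poly_time l" and i: "poly_time i"
    and g: "poly_time (\<lambda>z. g (hd_tree z) (hd_tree (tl_tree z)) (tl_tree (tl_tree z)))"
    and Q: "poly_bounded Q"
    and le: "\<And>x n. size (foldl (\<lambda>a y. g a y x) (i x) (take n (list_of_tree (l x)))) \<le> Q x"
  shows "poly_time (\<lambda>x. foldl (\<lambda>a y. g a y x) (i x) (list_of_tree (l x)))"
  unfolding poly_time_def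
proof
  fix b
  obtain c1 T1 where T1: "poly_bounded T1" and c1: "computes_at c1 b (b+1) l T1"
    using poly_time_fresh[OF l] .
  obtain c2 T2 where T2: "poly_bounded T2" and c2: "computes_at c2 b (b+2) i T2"
    using poly_time_fresh[OF i] .
  obtain c T where T: "poly_bounded T" and c: "computes_at c (b+3) (b+3)
      (\<lambda>z. g (hd_tree z) (hd_tree (tl_tree z)) (tl_tree (tl_tree z))) T"
    using poly_timeE[OF g] .
  obtain p where p: "\<forall>x. T x \<le> poly p (size x)"
    using T unfolding poly_bounded_def by blast
  \<comment> \<open>The triple passed to \<open>c\<close> consists of accumulator, list element and
    context, joined by two inner nodes.\<close>
  define B where "B x = poly p (Q x + size (l x) + size x + 2)" for x
  let ?D = "\<lambda>x. (size (l x) + 1) * (B x + 10 * (Q x + size (l x) + size x) + 30)"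
  let ?loop = "While (Var (b+1))
    (Seq (Assign (b+3) (Cons_e (Var (b+2)) (Cons_e (Hd (Var (b+1))) (Var b))))
    (Seq c (Seq (Assign (b+2) (Var (b+3))) (Assign (b+1) (Tl (Var (b+1)))))))"
  let ?f = "\<lambda>x. foldl (\<lambda>a y. g a y x) (i x) (list_of_tree (l x))"
  let ?T = "\<lambda>x. T1 x + T2 x + ?D x + size (?f x) + 10"
  have "computes_at (Seq c1 (Seq c2 (Seq ?loop (Assign b (Var (b+2)))))) b b ?f ?T"
  proof (rule computes_atI)
    fix s :: store
    let ?x = "s b"
    obtain t1 s1 where 1: "exec c1 s t1 s1" "s1 (b+1) = l ?x" "\<forall>i<b+1. s1 i = s i"
      "t1 \<le> T1 ?x"
      using computes_atE[OF c1, where s = s] .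
    obtain t2 s2 where 2: "exec c2 s1 t2 s2" "s2 (b+2) = i (s1 b)" "\<forall>i<b+2. s2 i = s1 i"
      "t2 \<le> T2 (s1 b)"
      using computes_atE[OF c2, where s = s1] .
    have s2: "s2 b = ?x" "s2 (b+1) = tree_of_list (list_of_tree (l ?x))" "s2 (b+2) = i ?x"
      "\<And>i. i \<le> b \<Longrightarrow> s2 i = s i"
      using 1 2 by auto
    have TB: "T z \<le> B ?x" if "size z \<le> Q ?x + size (l ?x) + size ?x + 2" for z
      using p poly_nat_mono[OF that, of p] le_trans unfolding B_def by blast
    have "\<exists>t s'. exec ?loop s2 t s' \<and> s' (b+2) = ?f ?x \<and> (\<forall>i\<le>b. s' i = s2 i) \<and>
        t \<le> (length (list_of_tree (l ?x)) + 1) *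
          (B ?x + 10 * (Q ?x + size (l ?x) + size ?x) + 30)"
      by (rule exec_fold_loop[OF c TB s2(1-3)]) (simp_all add: le)
    then obtain t3 s3 where 3: "exec ?loop s2 t3 s3" "s3 (b+2) = ?f ?x" "\<forall>i\<le>b. s3 i = s2 i"
      "t3 \<le> (length (list_of_tree (l ?x)) + 1) * (B ?x + 10 * (Q ?x + size (l ?x) + size ?x) + 30)"
      by blast
    have "length (list_of_tree (l ?x)) \<le> size (l ?x)"
      using length_le_size_tree_of_list[of "list_of_tree (l ?x)"] by simp
    then have D: "t3 \<le> ?D ?x"
      using 3(4) by (meson add_le_mono1 le_trans mult_le_mono1)
    have s3: "s1 b = ?x" "\<forall>i<b. s3 i = s i" using 1 s2 3 by auto
    have "exec (Assign b (Var (b+2))) s3 (size (?f ?x) + 2) (s3(b := ?f ?x))"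
      using exec.Assign[of b "Var (b+2)" s3] 3(2) by simp
    from exec.Seq[OF 1(1) exec.Seq[OF 2(1) exec.Seq[OF 3(1) this]]]
    have ex: "exec (Seq c1 (Seq c2 (Seq ?loop (Assign b (Var (b+2)))))) s
        (Suc (t1 + Suc (t2 + Suc (t3 + (size (?f ?x) + 2))))) (s3(b := ?f ?x))" .
    moreover have "Suc (t1 + Suc (t2 + Suc (t3 + (size (?f ?x) + 2)))) \<le> ?T ?x"
      using D 1(4) 2(4) s3(1) by simp
    ultimately show "\<exists>t s'. exec (Seq c1 (Seq c2 (Seq ?loop (Assign b (Var (b+2)))))) s t s' \<and>
        s' b = ?f ?x \<and> (\<forall>i<b. s' i = s i) \<and> t \<le> ?T ?x"
      using s3(2) by - (rule exI, rule exI, rule conjI, assumption, auto)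
  qed
  moreover have "size (?f x) \<le> Q x" for x
    using le[of x "length (list_of_tree (l x))"] by simp
  then have f: "poly_bounded (\<lambda>x. size (?f x))"
    using poly_bounded_le[OF Q, of "\<lambda>x. size (?f x)"] by blast
  have "poly_bounded ?T"
    unfolding B_def by (intro poly_bounded_intros T1 T2 Q f poly_time_size[OF l])
  ultimately show "\<exists>c T. poly_bounded T \<and> computes_at c b b ?f T"
    by blast
qed


section \<open>Closure properties\<close>

definition poly_time_list :: "(tree \<Rightarrow> tree list) \<Rightarrow> bool" where
  "poly_time_list f \<longleftrightarrow> poly_time (\<lambda>x. tree_of_list (f x))"

definition poly_time_pred :: "(tree \<Rightarrow> bool) \<Rightarrow> bool" where
  "poly_time_pred P \<longleftrightarrow> poly_time (\<lambda>x. tree_of_bool (P x))"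

lemma poly_time_hd: "poly_time f \<Longrightarrow> poly_time (\<lambda>x. hd_tree (f x))"
  by (rule poly_time_comp[OF poly_time_hd_tree])

lemma poly_time_tl: "poly_time f \<Longrightarrow> poly_time (\<lambda>x. tl_tree (f x))"
  by (rule poly_time_comp[OF poly_time_tl_tree])

lemma poly_time_of_pred: "poly_time_pred P \<Longrightarrow> poly_time (\<lambda>x. tree_of_bool (P x))"
  by (simp add: poly_time_pred_def)

lemma poly_time_of_list: "poly_time_list f \<Longrightarrow> poly_time (\<lambda>x. tree_of_list (f x))"
  by (simp add: poly_time_list_def)

lemma poly_time_if:
  assumes "poly_time_pred P" "poly_time f" "poly_time g"
  shows "poly_time (\<lambda>x. if P x then f x else g x)"
  using poly_time_if_Leaf[OF assms(1)[unfolded poly_time_pred_def] assms(2,3)] by simp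

lemma poly_time_pred_eq:
  assumes "poly_time f" "poly_time g"
  shows "poly_time_pred (\<lambda>x. f x = g x)"
  using poly_time_comp[OF poly_time_eq_components poly_time_Node[OF assms]]
  by (simp add: poly_time_pred_def)

lemma poly_time_pred_not:
  assumes "poly_time_pred P"
  shows "poly_time_pred (\<lambda>x. \<not> P x)"
  using poly_time_pred_eq[OF poly_time_of_pred[OF assms] poly_time_const[of Leaf]] by simp

lemma poly_time_pred_conj:
  assumes "poly_time_pred P" "poly_time_pred Q"
  shows "poly_time_pred (\<lambda>x. P x \<and> Q x)"
proof -
  have "tree_of_bool (P x \<and> Q x) = (if P x then tree_of_bool (Q x) else Leaf)" for x
    by simp
  then show ?thesis
    using poly_time_if[OF assms(1) poly_time_of_pred[OF assms(2)] poly_time_const[of Leaf]]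
    unfolding poly_time_pred_def by presburger
qed

lemma poly_time_pred_disj:
  assumes "poly_time_pred P" "poly_time_pred Q"
  shows "poly_time_pred (\<lambda>x. P x \<or> Q x)"
  using poly_time_pred_not[OF poly_time_pred_conj[OF assms[THEN poly_time_pred_not]]] by simp

lemma poly_time_list_const: "poly_time_list (\<lambda>_. xs)"
  by (simp add: poly_time_list_def poly_time_const)

lemma poly_time_list_of_tree: "poly_time f \<Longrightarrow> poly_time_list (\<lambda>x. list_of_tree (f x))"
  by (simp add: poly_time_list_def)

lemma poly_time_list_Cons:
  "poly_time f \<Longrightarrow> poly_time_list l \<Longrightarrow> poly_time_list (\<lambda>x. f x # l x)"
  by (simp add: poly_time_list_def poly_time_Node)

lemma poly_time_list_comp: "poly_time_list g \<Longrightarrow> poly_time f \<Longrightarrow> poly_time_list (\<lambda>x. g (f x))"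
  unfolding poly_time_list_def by (rule poly_time_comp)

lemma poly_bounded_size_list:
  "poly_time_list l \<Longrightarrow> poly_bounded (\<lambda>x. size (tree_of_list (l x)))"
  unfolding poly_time_list_def by (rule poly_time_size)

lemma poly_time_fold:
  assumes "poly_time_list l" "poly_time i"
    "poly_time (\<lambda>z. g (hd_tree z) (hd_tree (tl_tree z)) (tl_tree (tl_tree z)))"
    "poly_bounded Q"
    "\<And>x n. size (foldl (\<lambda>a y. g a y x) (i x) (take n (l x))) \<le> Q x"
  shows "poly_time (\<lambda>x. foldl (\<lambda>a y. g a y x) (i x) (l x))"
  using poly_time_foldl[OF poly_time_of_list[OF assms(1)] assms(2-4)] assms(5) by simp

lemma foldl_Node: "foldl (\<lambda>a y. Node (F y) a) (tree_of_list zs) xs = tree_of_list (rev (map F xs) @ zs)"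
  by (induction xs arbitrary: zs) (simp_all flip: tree_of_list.simps(2))

lemma size_tree_of_list_map: "size (tree_of_list (map f xs)) = (\<Sum>y\<leftarrow>xs. size (f y) + 1)"
  by (induction xs) auto

lemma size_tree_of_list_take_le: "size (tree_of_list (take n xs)) \<le> size (tree_of_list xs)"
proof (induction xs arbitrary: n)
  case (Cons x xs)
  then show ?case by (cases n) auto
qed simp

lemma size_tree_of_list_append:
  "size (tree_of_list (xs @ ys)) = size (tree_of_list xs) + size (tree_of_list ys)"
  by (simp add: size_tree_of_list)

lemma size_tree_of_list_rev: "size (tree_of_list (rev xs)) = size (tree_of_list xs)"
  by (induction xs) (simp_all add: size_tree_of_list_append)

text \<open>A loop that conses reverses its list, so this is the natural primitive. Reversal is the
  case of an empty tail, and appending follows by reversing beforehand.\<close>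

lemma poly_time_list_rev_append:
  assumes "poly_time_list l" "poly_time_list m"
  shows "poly_time_list (\<lambda>x. rev (l x) @ m x)"
proof -
  have "poly_time (\<lambda>x. foldl (\<lambda>a y. Node y a) (tree_of_list (m x)) (l x))"
  proof (rule poly_time_fold[where g = "\<lambda>a y x. Node y a"])
    show "poly_bounded (\<lambda>x. size (tree_of_list (l x)) + size (tree_of_list (m x)))"
      by (intro poly_bounded_intros poly_bounded_size_list assms)
    show "size (foldl (\<lambda>a y. Node y a) (tree_of_list (m x)) (take n (l x)))
        \<le> size (tree_of_list (l x)) + size (tree_of_list (m x))" for x n
      using foldl_Node[of "\<lambda>y. y"] size_tree_of_list_take_le[of n "l x"]
      by (simp add: size_tree_of_list_append size_tree_of_list_rev)
  qed (intro assms poly_time_of_list poly_time_Node poly_time_hd poly_time_tl poly_time_id)+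
  then show ?thesis
    using foldl_Node[of "\<lambda>y. y"] by (simp add: poly_time_list_def)
qed

lemma poly_time_list_rev:
  assumes "poly_time_list l"
  shows "poly_time_list (\<lambda>x. rev (l x))"
  using poly_time_list_rev_append[OF assms poly_time_list_const[of "[]"]] by simp

lemma poly_time_list_append:
  assumes "poly_time_list l" "poly_time_list m"
  shows "poly_time_list (\<lambda>x. l x @ m x)"
  using poly_time_list_rev_append[OF poly_time_list_rev[OF assms(1)] assms(2)] by simp

text \<open>\<open>F\<close> may depend on the context \<open>x\<close>: its program receives the list element paired with \<open>x\<close>.\<close>

lemma poly_time_list_map:
  assumes l: "poly_time_list l" and F: "poly_time (\<lambda>z. F (hd_tree z) (tl_tree z))"
  shows "poly_time_list (\<lambda>x. map (\<lambda>y. F y x) (l x))"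
proof -
  obtain p where p: "\<And>z. size (F (hd_tree z) (tl_tree z)) \<le> poly p (size z)"
    using poly_time_size[OF F] unfolding poly_bounded_def by blast
  let ?L = "\<lambda>x. size (tree_of_list (l x))"
  \<comment> \<open>There are at most \<open>?L x\<close> elements; each is passed to
    \<open>F\<close> in a pair with \<open>x\<close> of size at most
    \<open>?L x + size x + 1\<close>, and each result costs one further list node.\<close>
  let ?Q = "\<lambda>x. ?L x * (poly p (?L x + size x + 1) + 1)"
  have "poly_time (\<lambda>x. foldl (\<lambda>a y. Node (F y x) a) Leaf (l x))"
  proof (rule poly_time_fold[where g = "\<lambda>a y x. Node (F y x) a"])
    show "poly_time (\<lambda>z. Node (F (hd_tree (tl_tree z)) (tl_tree (tl_tree z))) (hd_tree z))"
      by (intro poly_time_Node poly_time_comp[OF F] poly_time_hd poly_time_tl poly_time_id)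
    show "poly_bounded ?Q"
      by (intro poly_bounded_intros poly_bounded_size_list l)
    show "size (foldl (\<lambda>a y. Node (F y x) a) Leaf (take n (l x))) \<le> ?Q x" for x n
    proof -
      have F_le: "size (F y x) \<le> poly p (?L x + size x + 1)" if "y \<in> set (l x)" for y
      proof -
        have "size (Node y x) \<le> ?L x + size x + 1"
          using size_le_size_tree_of_list[OF that] by simp
        then have "poly p (size (Node y x)) \<le> poly p (?L x + size x + 1)"
          by (rule poly_nat_mono)
        with p[of "Node y x"] show ?thesis by simp
      qed
      have "size (foldl (\<lambda>a y. Node (F y x) a) Leaf (take n (l x)))
          = size (tree_of_list (map (\<lambda>y. F y x) (take n (l x))))"
        using foldl_Node[of "\<lambda>y. F y x" "[]" "take n (l x)"] by (simp add: size_tree_of_list_rev)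
      also have "\<dots> \<le> size (tree_of_list (map (\<lambda>y. F y x) (l x)))"
        unfolding take_map[symmetric] by (rule size_tree_of_list_take_le)
      also have "\<dots> = (\<Sum>y\<leftarrow>l x. size (F y x) + 1)"
        by (rule size_tree_of_list_map)
      also have "\<dots> \<le> (\<Sum>y\<leftarrow>l x. poly p (?L x + size x + 1) + 1)"
        using F_le by (intro sum_list_mono) simp
      also have "\<dots> = length (l x) * (poly p (?L x + size x + 1) + 1)"
        by (simp add: sum_list_triv)
      also have "\<dots> \<le> ?Q x"
        by (intro mult_le_mono1 length_le_size_tree_of_list)
      finally show ?thesis .
    qed
  qed (intro l poly_time_const)+
  moreover have "(\<lambda>x. foldl (\<lambda>a y. Node (F y x) a) Leaf (l x)) =
      (\<lambda>x. tree_of_list (rev (map (\<lambda>y. F y x) (l x))))"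
    using foldl_Node[of _ "[]"] by (intro ext) simp
  ultimately have "poly_time_list (\<lambda>x. rev (map (\<lambda>y. F y x) (l x)))"
    by (simp only: poly_time_list_def)
  from poly_time_list_rev[OF this] show ?thesis by simp
qed

text \<open>Concatenation only rearranges material already present in \<open>l x\<close>, so the
  accumulator never outgrows that list.\<close>

lemma poly_time_list_concat:
  assumes "poly_time_list l"
  shows "poly_time_list (\<lambda>x. concat (map list_of_tree (l x)))"
proof -
  let ?f = "\<lambda>xs. foldl (\<lambda>a y. tree_of_list (list_of_tree a @ list_of_tree y)) Leaf xs"
  have f: "?f xs = tree_of_list (concat (map list_of_tree xs))" for xs
    by (induction xs rule: rev_induct) auto
  have size: "size (?f xs) \<le> size (tree_of_list xs)" for xs
    unfolding f by (induction xs) (simp_all add: size_tree_of_list_append)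
  have "poly_time (\<lambda>x. ?f (l x))"
  proof (rule poly_time_fold[where g = "\<lambda>a y x. tree_of_list (list_of_tree a @ list_of_tree y)"])
    show "poly_bounded (\<lambda>x. size (tree_of_list (l x)))"
      by (intro poly_bounded_size_list assms)
    show "size (?f (take n (l x))) \<le> size (tree_of_list (l x))" for x n
      using size[of "take n (l x)"] size_tree_of_list_take_le[of n "l x"] by (rule le_trans)
  qed (intro assms poly_time_const poly_time_of_list poly_time_list_append poly_time_list_of_tree
      poly_time_hd poly_time_tl poly_time_id)+
  then show ?thesis by (simp add: f poly_time_list_def)
qed

lemma poly_time_list_concat_map:
  assumes "poly_time_list l" "poly_time_list (\<lambda>z. F (hd_tree z) (tl_tree z))"
  shows "poly_time_list (\<lambda>x. concat (map (\<lambda>y. F y x) (l x)))"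
  using poly_time_list_concat[OF poly_time_list_map[OF assms(1),
        where F = "\<lambda>y x. tree_of_list (F y x)"]] assms(2)
  by (simp add: poly_time_list_def o_def)

text \<open>Filtering concatenates lists of length at most one, so no new loop has to be
  analysed.\<close>

lemma poly_time_list_filter:
  assumes "poly_time_list l" "poly_time_pred (\<lambda>z. P (hd_tree z) (tl_tree z))"
  shows "poly_time_list (\<lambda>x. filter (\<lambda>y. P y x) (l x))"
proof -
  have "poly_time (\<lambda>z. if P (hd_tree z) (tl_tree z) then Node (hd_tree z) Leaf else Leaf)"
    by (intro poly_time_if assms poly_time_Node poly_time_hd poly_time_id poly_time_const)
  moreover have "(if P y x then Node y Leaf else Leaf) = tree_of_list (if P y x then [y] else [])"
    for x y by simp
  ultimately have "poly_time_list (\<lambda>z. if P (hd_tree z) (tl_tree z) then [hd_tree z] else [])"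
    by (simp add: poly_time_list_def)
  then have "poly_time_list (\<lambda>x. concat (map (\<lambda>y. if P y x then [y] else []) (l x)))"
    by (rule poly_time_list_concat_map[OF assms(1)])
  moreover have "concat (map (\<lambda>y. if Q y then [y] else []) xs) = filter Q xs" for Q and xs :: "tree list"
    by (induction xs) auto
  ultimately show ?thesis by simp
qed

lemma poly_time_pred_list_ex:
  assumes "poly_time_list l" "poly_time_pred (\<lambda>z. P (hd_tree z) (tl_tree z))"
  shows "poly_time_pred (\<lambda>x. \<exists>y\<in>set (l x). P y x)"
proof -
  have "poly_time_pred (\<lambda>x. tree_of_list (filter (\<lambda>y. P y x) (l x)) \<noteq> tree_of_list [])"
    by (intro poly_time_pred_not poly_time_pred_eq poly_time_of_list poly_time_list_filter assms
        poly_time_list_const)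
  moreover have "(tree_of_list (filter (\<lambda>y. P y x) (l x)) \<noteq> tree_of_list [])
      \<longleftrightarrow> (\<exists>y\<in>set (l x). P y x)" for x
    by (simp only: tree_of_list_eq_iff filter_empty_conv) blast
  ultimately show ?thesis by simp
qed

lemma poly_time_pred_list_all:
  assumes "poly_time_list l" "poly_time_pred (\<lambda>z. P (hd_tree z) (tl_tree z))"
  shows "poly_time_pred (\<lambda>x. \<forall>y\<in>set (l x). P y x)"
  using poly_time_pred_not[OF poly_time_pred_list_ex[OF assms(1), OF poly_time_pred_not[OF assms(2)]]]
  by simp


section \<open>Unary numbers and list indexing\<close>

definition tree_of_nat :: "nat \<Rightarrow> tree" where
  "tree_of_nat n = tree_of_list (replicate n Leaf)"

definition nth_tree :: "tree \<Rightarrow> tree \<Rightarrow> tree" where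
  "nth_tree t i = hd_tree (foldl (\<lambda>a _. tl_tree a) t (list_of_tree i))"

lemma tree_of_nat_eq_iff [simp]: "tree_of_nat m = tree_of_nat n \<longleftrightarrow> m = n"
  by (simp add: tree_of_nat_def)

lemma size_tree_of_nat: "size (tree_of_nat n) = n"
  by (simp add: tree_of_nat_def size_tree_of_list sum_list_replicate)

lemma nth_tree_of_nat:
  assumes "n < length xs"
  shows "nth_tree (tree_of_list xs) (tree_of_nat n) = xs ! n"
proof -
  have "foldl (\<lambda>a _. tl_tree a) (tree_of_list xs) (replicate n Leaf) = tree_of_list (drop n xs)"
    if "n \<le> length xs" for n using that
  proof (induction n arbitrary: xs)
    case (Suc n)
    then obtain y ys where "xs = y # ys" by (cases xs) auto
    with Suc show ?case by simp
  qed simp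
  with assms show ?thesis
    by (simp add: nth_tree_def tree_of_nat_def flip: Cons_nth_drop_Suc)
qed

lemma poly_time_nth_tree:
  assumes "poly_time f" "poly_time g"
  shows "poly_time (\<lambda>x. nth_tree (f x) (g x))"
proof -
  have size: "size (foldl (\<lambda>a _. tl_tree a) t ys) \<le> size t" for t and ys :: "tree list"
    by (induction ys arbitrary: t) (use size_tl_tree_le le_trans in fastforce)+
  have "poly_time (\<lambda>x. foldl (\<lambda>a y. tl_tree a) (f x) (list_of_tree (g x)))"
    by (rule poly_time_fold[where g = "\<lambda>a y x. tl_tree a" and Q = "\<lambda>x. size (f x)"])
      (intro assms poly_time_list_of_tree poly_time_tl poly_time_hd poly_time_id poly_time_size size)+
  then show ?thesis unfolding nth_tree_def by (rule poly_time_hd)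
qed

text \<open>Each round conses the successor of the current head, so the indices appear in decreasing
  order. The fold starts from the list containing only 0 and thus produces one index too many, the
  length itself, which \<open>tl_tree\<close> removes.\<close>

definition positions :: "tree list \<Rightarrow> tree list" where
  "positions xs = list_of_tree (tl_tree
     (foldl (\<lambda>a y. Node (Node Leaf (hd_tree a)) a) (Node Leaf Leaf) xs))"

lemma foldl_positions:
  "foldl (\<lambda>a y. Node (Node Leaf (hd_tree a)) a) (Node Leaf Leaf) xs =
   tree_of_list (map tree_of_nat (rev [0..<Suc (length xs)]))"
  by (induction xs rule: rev_induct) (simp_all add: tree_of_nat_def)

lemma positions_eq: "positions xs = map tree_of_nat (rev [0..<length xs])"
  unfolding positions_def foldl_positions by simp

lemma poly_time_list_positions:
  assumes "poly_time_list l"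
  shows "poly_time_list (\<lambda>x. positions (l x))"
proof -
  let ?L = "\<lambda>x. size (tree_of_list (l x)) + 1"
  have "poly_time (\<lambda>x. foldl (\<lambda>a y. Node (Node Leaf (hd_tree a)) a) (Node Leaf Leaf) (l x))"
  proof (rule poly_time_fold[where g = "\<lambda>a y x. Node (Node Leaf (hd_tree a)) a" and
        Q = "\<lambda>x. ?L x * ?L x + ?L x"])
    show "poly_bounded (\<lambda>x. ?L x * ?L x + ?L x)"
      by (intro poly_bounded_intros poly_bounded_size_list assms)
    show "size (foldl (\<lambda>a y. Node (Node Leaf (hd_tree a)) a) (Node Leaf Leaf) (take n (l x)))
        \<le> ?L x * ?L x + ?L x" for x n
    proof -
      define m where "m = length (take n (l x))"
      have m: "m \<le> size (tree_of_list (l x))"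
        using length_le_size_tree_of_list[of "l x"] by (simp add: m_def)
      have "size (tree_of_list (map tree_of_nat (rev [0..<Suc m]))) = (\<Sum>k\<leftarrow>[0..<Suc m]. k) + Suc m"
        unfolding rev_map size_tree_of_list_rev
        by (simp add: size_tree_of_list size_tree_of_nat o_def del: upt_Suc)
      also have "\<dots> \<le> (\<Sum>k\<leftarrow>[0..<Suc m]. m) + Suc m"
        by (intro add_mono sum_list_mono) auto
      also have "\<dots> = Suc m * m + Suc m"
        by (simp add: sum_list_triv del: upt_Suc)
      also have "\<dots> \<le> ?L x * ?L x + ?L x"
        using m by (intro add_mono mult_le_mono) auto
      finally show ?thesis unfolding foldl_positions m_def .
    qed
  qed (intro assms poly_time_const poly_time_Node poly_time_hd poly_time_id)+
  then show ?thesis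
    unfolding positions_def by (intro poly_time_list_of_tree poly_time_tl)
qed

lemmas poly_time_intros =
  poly_time_id poly_time_const poly_time_Node poly_time_hd poly_time_tl poly_time_if
  poly_time_of_pred poly_time_of_list poly_time_nth_tree
  poly_time_pred_eq poly_time_pred_not poly_time_pred_conj poly_time_pred_disj
  poly_time_pred_list_ex poly_time_pred_list_all
  poly_time_list_const poly_time_list_of_tree poly_time_list_Cons poly_time_list_append
  poly_time_list_map poly_time_list_concat_map poly_time_list_filter poly_time_list_positions


section \<open>The kernelization algorithm\<close>

text \<open>Each round either keeps a sequence or extends it by one entry, so short sequences are
  listed repeatedly. Repetitions merely create twins in the kernel and are already counted in
  \<open>(length xs + 1) ^ c\<close>.\<close>

fun lists_upto :: "nat \<Rightarrow> 'a list \<Rightarrow> 'a list list" where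
  "lists_upto 0 xs = [[]]"
| "lists_upto (Suc c) xs = concat (map (\<lambda>t. t # map (\<lambda>x. x # t) xs) (lists_upto c xs))"

lemma length_lists_upto: "length (lists_upto c xs) = (length xs + 1) ^ c"
  by (induction c) (simp_all add: length_concat o_def sum_list_triv)

lemma set_lists_upto: "set (lists_upto c xs) = {t. set t \<subseteq> set xs \<and> length t \<le> c}"
proof (induction c)
  case (Suc c)
  let ?S = "\<lambda>c. {t. set t \<subseteq> set xs \<and> length t \<le> c}"
  have "set (lists_upto (Suc c) xs) = ?S c \<union> {x # t | x t. x \<in> set xs \<and> t \<in> ?S c}"
    using Suc by auto
  also have "\<dots> = ?S (Suc c)"
  proof (intro equalityI subsetI)
    fix t assume "t \<in> ?S (Suc c)"
    then show "t \<in> ?S c \<union> {x # t | x t. x \<in> set xs \<and> t \<in> ?S c}"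
      by (cases t) auto
  qed auto
  finally show ?case .
qed auto

lemma lists_upto_map: "lists_upto c (map f xs) = map (map f) (lists_upto c xs)"
  by (induction c) (simp_all add: map_concat o_def)

fun list_trees_upto :: "nat \<Rightarrow> tree list \<Rightarrow> tree list" where
  "list_trees_upto 0 xs = [Leaf]"
| "list_trees_upto (Suc c) xs = concat (map (\<lambda>t. t # map (\<lambda>x. Node x t) xs) (list_trees_upto c xs))"

lemma list_trees_upto_eq: "list_trees_upto c xs = map tree_of_list (lists_upto c xs)"
  by (induction c) (simp_all add: map_concat o_def)

text \<open>The induction is over \<open>c\<close>, a constant depending only on \<open>H\<close>,
  so the polynomial may change from one step to the next.\<close>

lemma poly_time_list_trees_upto:
  assumes "poly_time_list l"
  shows "poly_time_list (\<lambda>x. list_trees_upto c (l x))"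
proof (induction c)
  case 0
  then show ?case by (simp add: poly_time_list_const)
next
  case (Suc c)
  then show ?case
    unfolding list_trees_upto.simps
    by (intro poly_time_intros poly_time_list_comp[OF assms])
qed

definition adjacent_tree :: "tree \<Rightarrow> tree \<Rightarrow> tree \<Rightarrow> bool" where
  "adjacent_tree M u v \<longleftrightarrow> nth_tree (nth_tree M u) v \<noteq> Leaf"

lemma poly_time_adjacent_tree:
  assumes "poly_time M" "poly_time u" "poly_time v"
  shows "poly_time_pred (\<lambda>x. adjacent_tree (M x) (u x) (v x))"
  unfolding adjacent_tree_def by (intro poly_time_intros assms)

text \<open>Tree counterpart of \<open>kernel_vertices\<close>: the descriptor
  \<open>(l, t, q)\<close> is stored as \<open>Node l (Node t q)\<close>, and
  \<open>Node v Leaf\<close> is the one-element list of \<open>v\<close>. The argument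
  \<open>cs\<close> is meant to hold the codes of all subsets of \<open>verts H\<close>, a constant
  of the program.\<close>

definition kernel_vertex_trees :: "nat \<Rightarrow> tree list \<Rightarrow> tree \<Rightarrow> tree \<Rightarrow> tree \<Rightarrow> tree list" where
  "kernel_vertex_trees c cs M Ls xb =
     map (\<lambda>v. Node (nth_tree Ls v) (Node Leaf (Node v Leaf)))
       (filter (\<lambda>v. nth_tree xb v \<noteq> Leaf) (positions (list_of_tree M))) @
     filter (\<lambda>d. \<exists>v\<in>set (positions (list_of_tree M)). nth_tree xb v = Leaf \<and>
         nth_tree Ls v = hd_tree d \<and>
         (\<forall>y\<in>set (list_of_tree (hd_tree (tl_tree d))). adjacent_tree M v y))
       (concat (map (\<lambda>t. map (\<lambda>l. Node l (Node t Leaf)) cs)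
         (list_trees_upto c (filter (\<lambda>v. nth_tree xb v \<noteq> Leaf) (positions (list_of_tree M))))))"

lemma poly_time_kernel_vertex_trees:
  assumes "poly_time M" "poly_time Ls" "poly_time xb"
  shows "poly_time_list (\<lambda>x. kernel_vertex_trees c cs (M x) (Ls x) (xb x))"
  unfolding kernel_vertex_trees_def
  by (intro poly_time_intros poly_time_list_trees_upto poly_time_adjacent_tree
      assms assms[THEN poly_time_comp])

definition kernel_adjacent_tree :: "tree \<Rightarrow> tree \<Rightarrow> tree \<Rightarrow> bool" where
  "kernel_adjacent_tree M d e \<longleftrightarrow>
     (\<exists>x\<in>set (list_of_tree (tl_tree (tl_tree d))). \<exists>y\<in>set (list_of_tree (tl_tree (tl_tree e))).
       adjacent_tree M x y) \<or>
     (\<exists>x\<in>set (list_of_tree (tl_tree (tl_tree d))). \<exists>y\<in>set (list_of_tree (hd_tree (tl_tree e))). x = y) \<or>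
     (\<exists>x\<in>set (list_of_tree (tl_tree (tl_tree e))). \<exists>y\<in>set (list_of_tree (hd_tree (tl_tree d))). x = y)"

lemma poly_time_kernel_adjacent_tree:
  assumes "poly_time M" "poly_time d" "poly_time e"
  shows "poly_time_pred (\<lambda>x. kernel_adjacent_tree (M x) (d x) (e x))"
  unfolding kernel_adjacent_tree_def
  by (intro poly_time_intros poly_time_adjacent_tree assms assms[THEN poly_time_comp])

definition graph_tree_of_list :: "(tree \<Rightarrow> tree \<Rightarrow> bool) \<Rightarrow> tree list \<Rightarrow> tree" where
  "graph_tree_of_list R W =
     Node (tree_of_list (map (\<lambda>d. tree_of_list (map (\<lambda>e. tree_of_bool (R d e)) W)) W))
       (tree_of_list (map hd_tree W))"

definition kernel_tree :: "nat \<Rightarrow> tree list \<Rightarrow> tree \<Rightarrow> tree" where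
  "kernel_tree c cs z = graph_tree_of_list (kernel_adjacent_tree (hd_tree (hd_tree z)))
     (kernel_vertex_trees c cs (hd_tree (hd_tree z)) (tl_tree (hd_tree z)) (tl_tree z))"

lemma poly_time_kernel_tree: "poly_time (kernel_tree c cs)"
  unfolding kernel_tree_def[abs_def] graph_tree_of_list_def
  by (intro poly_time_intros poly_time_kernel_vertex_trees poly_time_kernel_adjacent_tree)

text \<open>Here \<open>nil\<close> stands for the code of the empty list of colors and
  \<open>bad\<close> for a table of all pairs of lists with no edge of \<open>H\<close> between
  them. Both are constants of the program, so adjacency in \<open>H\<close> is never computed at run
  time.\<close>

definition locally_bad_tree :: "tree \<Rightarrow> tree list \<Rightarrow> tree \<Rightarrow> bool" where
  "locally_bad_tree nil bad z \<longleftrightarrow>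
     (\<exists>u\<in>set (positions (list_of_tree (hd_tree (hd_tree z)))).
       nth_tree (tl_tree (hd_tree z)) u = nil \<or>
       (\<exists>v\<in>set (positions (list_of_tree (hd_tree (hd_tree z)))).
         adjacent_tree (hd_tree (hd_tree z)) u v \<and>
         (\<exists>p\<in>set bad. p = Node (nth_tree (tl_tree (hd_tree z)) u) (nth_tree (tl_tree (hd_tree z)) v))))"

lemma poly_time_locally_bad_tree: "poly_time_pred (locally_bad_tree nil bad)"
  unfolding locally_bad_tree_def[abs_def]
  by (intro poly_time_intros poly_time_adjacent_tree)

section \<open>Minimal obstructions\<close>

lemma adjacent_commute: "adjacent G u v \<longleftrightarrow> adjacent G v u"
  by (simp add: adjacent_def insert_commute)

lemma adjacent_verts: "graph G \<Longrightarrow> adjacent G u v \<Longrightarrow> u \<in> verts G \<and> v \<in> verts G"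
  unfolding graph_def adjacent_def by (auto simp: doubleton_eq_iff)

lemma minimal_obstruction_exists:
  assumes "finite S" "S \<subseteq> verts H" "\<not> has_common_neighbor H L S"
  shows "\<exists>T\<subseteq>S. minimal_obstruction H L T"
  using assms
proof (induction S rule: finite_psubset_induct)
  case (psubset S)
  show ?case
  proof (cases "\<forall>T. T \<subset> S \<longrightarrow> has_common_neighbor H L T")
    case True
    then show ?thesis using psubset.prems unfolding minimal_obstruction_def by blast
  next
    case False
    then show ?thesis using psubset by (meson order_trans psubset_imp_subset)
  qed
qed

lemma card_minimal_obstruction_le:
  assumes "graph H" "L \<subseteq> verts H" "minimal_obstruction H L S"
  shows "card S \<le> c_star H"
  unfolding c_star_def using finite_c_star_set[OF assms(1)] assms(2,3) by (intro Max_ge) auto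


section \<open>The case \<open>c_star H \<le> 1\<close>\<close>

definition neighbors :: "'h graph \<Rightarrow> 'h \<Rightarrow> 'h set" where
  "neighbors H a = {s. adjacent H a s}"

text \<open>If both inclusions fail, each of \<open>a\<close> and \<open>b\<close> has a private
  neighbor, \<open>s\<close> and \<open>t\<close>. Then neither vertex serves both, but each
  singleton is served, so \<open>{s, t}\<close> is a minimal obstruction of size 2 for
  \<open>{a, b}\<close>.\<close>

lemma neighbors_chain:
  assumes "graph H" "c_star H \<le> 1"
  shows "neighbors H a \<subseteq> neighbors H b \<or> neighbors H b \<subseteq> neighbors H a"
proof (rule ccontr)
  assume "\<not> ?thesis"
  then obtain s t where st: "adjacent H a s" "\<not> adjacent H b s" "adjacent H b t" "\<not> adjacent H a t"
    unfolding neighbors_def by blast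
  have "minimal_obstruction H {a, b} {s, t}"
    unfolding minimal_obstruction_def
  proof (intro conjI allI impI)
    show "{s, t} \<subseteq> verts H"
      using st adjacent_verts[OF assms(1)] by blast
    show "\<not> has_common_neighbor H {a, b} {s, t}"
      using st unfolding has_common_neighbor_def by blast
    fix T assume "T \<subset> {s, t}"
    then have "T \<subseteq> {s} \<or> T \<subseteq> {t}" by blast
    then show "has_common_neighbor H {a, b} T"
      using st unfolding has_common_neighbor_def by blast
  qed
  moreover have "{a, b} \<subseteq> verts H"
    using st adjacent_verts[OF assms(1)] by blast
  ultimately have "card {s, t} \<le> 1"
    using card_minimal_obstruction_le[OF assms(1)] assms(2) by (meson le_trans)
  moreover have "s \<noteq> t" using st by blast
  ultimately show False by simp
qed

definition locally_bad :: "'h graph \<Rightarrow> 'a graph \<Rightarrow> ('a \<Rightarrow> 'h set) \<Rightarrow> bool" where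
  "locally_bad H G L \<longleftrightarrow> (\<exists>u\<in>verts G. L u = {} \<or>
     (\<exists>v\<in>verts G. adjacent G u v \<and> (\<forall>a\<in>L u. \<forall>b\<in>L v. \<not> adjacent H a b)))"

lemma list_colorable_iff_not_locally_bad:
  assumes H: "graph H" "c_star H \<le> 1" and L: "lists_for H G L"
  shows "list_colorable H G L \<longleftrightarrow> \<not> locally_bad H G L"
proof
  assume "list_colorable H G L"
  then show "\<not> locally_bad H G L"
    unfolding list_colorable_def list_hom_def locally_bad_def by (metis empty_iff)
next
  assume good: "\<not> locally_bad H G L"
  have top: "\<exists>a\<in>S. \<forall>b\<in>S. neighbors H b \<subseteq> neighbors H a" if "finite S" "S \<noteq> {}" for S
    using that
  proof (induction S rule: finite_ne_induct)
    case (insert x S)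
    then obtain a where a: "a \<in> S" "\<forall>b\<in>S. neighbors H b \<subseteq> neighbors H a" by blast
    from neighbors_chain[OF H, of a x] show ?case
    proof
      assume "neighbors H a \<subseteq> neighbors H x"
      then show ?thesis using a by (intro bexI[of _ x]) auto
    next
      assume "neighbors H x \<subseteq> neighbors H a"
      then show ?thesis using a by (intro bexI[of _ a]) auto
    qed
  qed simp
  have "\<exists>a\<in>L v. \<forall>b\<in>L v. neighbors H b \<subseteq> neighbors H a" if "v \<in> verts G" for v
  proof (rule top)
    show "finite (L v)"
      using that L H(1) by (meson finite_subset graph_def lists_for_def)
    show "L v \<noteq> {}"
      using that good unfolding locally_bad_def by blast
  qed
  then obtain \<phi> where \<phi>: "\<forall>v\<in>verts G. \<phi> v \<in> L v \<and> (\<forall>b\<in>L v. neighbors H b \<subseteq> neighbors H (\<phi> v))"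
    by metis
  have "adjacent H (\<phi> u) (\<phi> v)" if uv: "u \<in> verts G" "v \<in> verts G" "adjacent G u v" for u v
  proof -
    \<comment> \<open>An edge between the two lists survives moving its ends, one after the other,
      to the dominating colors. This also covers a loop at \<open>u = v\<close>, where
      \<open>a\<close> and \<open>b\<close> may differ.\<close>
    obtain a b where "a \<in> L u" "b \<in> L v" "adjacent H a b"
      using uv good unfolding locally_bad_def by blast
    then have "adjacent H (\<phi> u) b"
      using \<phi> uv(1) unfolding neighbors_def by blast
    then have "adjacent H (\<phi> v) (\<phi> u)"
      using \<phi> uv(2) \<open>b \<in> L v\<close> adjacent_commute[of H b "\<phi> u"] unfolding neighbors_def by blast
    then show ?thesis by (simp only: adjacent_commute[of H "\<phi> u"])
  qed
  moreover have "\<phi> ` verts G \<subseteq> verts H"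
    using \<phi> L unfolding lists_for_def by blast
  ultimately show "list_colorable H G L"
    using \<phi> unfolding list_colorable_def list_hom_def by blast
qed


section \<open>Graphs given by lists of descriptors\<close>

definition graph_of_list :: "('d \<Rightarrow> 'd \<Rightarrow> bool) \<Rightarrow> 'd list \<Rightarrow> nat graph" where
  "graph_of_list R W = \<lparr>verts = {..<length W},
     edges = {{i, j} | i j. i < length W \<and> j < length W \<and> R (W ! i) (W ! j)}\<rparr>"

lemma verts_graph_of_list [simp]: "verts (graph_of_list R W) = {..<length W}"
  by (simp add: graph_of_list_def)

lemma graph_graph_of_list: "graph (graph_of_list R W)"
  unfolding graph_def graph_of_list_def by auto

lemma adjacent_graph_of_list:
  assumes "\<And>d e. R d e \<longleftrightarrow> R e d"
  shows "adjacent (graph_of_list R W) i j \<longleftrightarrow> i < length W \<and> j < length W \<and> R (W ! i) (W ! j)"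
  using assms by (auto simp: adjacent_def graph_of_list_def doubleton_eq_iff)

text \<open>A descriptor \<open>(l, t, q)\<close> stands for a vertex with list \<open>l\<close>: if \<open>q = [x]\<close> and \<open>t = []\<close>, for
  the vertex \<open>x\<close> of the vertex cover, and if \<open>q = []\<close>, for a new vertex with neighborhood
  \<open>t\<close>.\<close>

type_synonym 'h descriptor = "'h set \<times> nat list \<times> nat list"

text \<open>No case relates two descriptors with \<open>q = []\<close>: the new vertices are
  independent, and all their edges go to the cover.\<close>

definition kernel_adjacent :: "nat graph \<Rightarrow> 'h descriptor \<Rightarrow> 'h descriptor \<Rightarrow> bool" where
  "kernel_adjacent G d e \<longleftrightarrow>
     (\<exists>x\<in>set (snd (snd d)). \<exists>y\<in>set (snd (snd e)). adjacent G x y) \<or>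
     (\<exists>x\<in>set (snd (snd d)). \<exists>y\<in>set (fst (snd e)). x = y) \<or>
     (\<exists>x\<in>set (snd (snd e)). \<exists>y\<in>set (fst (snd d)). x = y)"

lemma kernel_adjacent_commute: "kernel_adjacent G d e \<longleftrightarrow> kernel_adjacent G e d"
proof -
  have "(\<exists>x\<in>A. \<exists>y\<in>B. adjacent G x y) \<longleftrightarrow> (\<exists>y\<in>B. \<exists>x\<in>A. adjacent G y x)" for A B
    by (subst adjacent_commute) blast
  then show ?thesis unfolding kernel_adjacent_def by (simp only: disj_commute disj_left_commute)
qed

text \<open>The reversal matches the decreasing order of \<open>positions\<close>, so that the tree
  computation yields the same list in the same order.\<close>

definition cover_list :: "nat graph \<Rightarrow> nat set \<Rightarrow> nat list" where
  "cover_list G X = filter (\<lambda>v. v \<in> X) (rev (vertex_list G))"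

definition new_vertices ::
  "nat \<Rightarrow> 'h list \<Rightarrow> nat graph \<Rightarrow> (nat \<Rightarrow> 'h set) \<Rightarrow> nat set \<Rightarrow> 'h descriptor list" where
  "new_vertices c hs G L X =
     filter (\<lambda>d. \<exists>v\<in>set (rev (vertex_list G)). v \<notin> X \<and> L v = fst d \<and>
         (\<forall>y\<in>set (fst (snd d)). adjacent G v y))
       (concat (map (\<lambda>t. map (\<lambda>l. (l, t, [])) (map set (subseqs hs)))
         (lists_upto c (cover_list G X))))"

definition kernel_vertices ::
  "nat \<Rightarrow> 'h list \<Rightarrow> nat graph \<Rightarrow> (nat \<Rightarrow> 'h set) \<Rightarrow> nat set \<Rightarrow> 'h descriptor list" where
  "kernel_vertices c hs G L X =
     map (\<lambda>v. (L v, [], [v])) (cover_list G X) @ new_vertices c hs G L X"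

lemma set_vertex_list: "verts G = {..<n} \<Longrightarrow> set (vertex_list G) = verts G"
  by (simp add: vertex_list_def lessThan_atLeast0)

lemma set_cover_list:
  assumes "verts G = {..<n}" "X \<subseteq> verts G"
  shows "set (cover_list G X) = X"
  unfolding cover_list_def set_filter set_rev set_vertex_list[OF assms(1)] using assms(2) by blast

lemma distinct_cover_list: "distinct (cover_list G X)"
  by (simp add: cover_list_def vertex_list_def)

lemma length_cover_list: "verts G = {..<n} \<Longrightarrow> X \<subseteq> verts G \<Longrightarrow> length (cover_list G X) = card X"
  using distinct_card[OF distinct_cover_list[of G X]] set_cover_list by metis

lemma set_new_vertices:
  assumes "verts G = {..<n}" "X \<subseteq> verts G"
  shows "set (new_vertices c hs G L X) = {(L v, t, []) | v t. v \<in> verts G - X \<and> L v \<subseteq> set hs \<and>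
    set t \<subseteq> X \<and> length t \<le> c \<and> (\<forall>y\<in>set t. adjacent G v y)}"
proof -
  have "set (concat (map (\<lambda>t. map (\<lambda>l. (l, t, [] :: nat list)) (map set (subseqs hs)))
      (lists_upto c (cover_list G X))))
      = (\<lambda>(t, l). (l, t, [])) ` (set (lists_upto c (cover_list G X)) \<times> set ` set (subseqs hs))"
    by auto
  also have "\<dots> = (\<lambda>(t, l). (l, t, [])) ` ({t. set t \<subseteq> X \<and> length t \<le> c} \<times> Pow (set hs))"
    by (simp only: subseqs_powset set_lists_upto set_cover_list[OF assms])
  finally show ?thesis
    unfolding new_vertices_def set_filter set_rev set_vertex_list[OF assms(1)]
    by (simp only:) (auto simp: image_iff)
qed

lemma length_new_vertices:
  assumes "verts G = {..<n}" "X \<subseteq> verts G"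
  shows "length (new_vertices c hs G L X) \<le> 2 ^ length hs * (card X + 1) ^ c"
proof -
  have "length (new_vertices c hs G L X) \<le> (length (lists_upto c (cover_list G X))) * 2 ^ length hs"
    unfolding new_vertices_def
    by (rule le_trans[OF length_filter_le])
      (simp add: length_concat o_def sum_list_triv length_subseqs)
  then show ?thesis
    by (simp add: length_lists_upto length_cover_list[OF assms] mult.commute)
qed

text \<open>An edge inside the cover is one of \<open>card X ^ 2\<close> pairs. Every other edge is
  determined by its new endpoint together with an index below \<open>c\<close> into the sequence of
  that endpoint.\<close>

lemma card_edges_kernel:
  assumes "verts G = {..<n}" "X \<subseteq> verts G"
  shows "card (edges (graph_of_list (kernel_adjacent G) (kernel_vertices c hs G L X)))
    \<le> card X ^ 2 + length (new_vertices c hs G L X) * c"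
proof -
  let ?A = "cover_list G X" and ?B = "new_vertices c hs G L X"
  let ?W = "kernel_vertices c hs G L X" and ?k = "length (cover_list G X)"
  \<comment> \<open>The cover vertices occupy the first positions without repetition, so a cover
    vertex determines its position.\<close>
  define idx where "idx = inv_into {..<?k} ((!) ?A)"
  have idx: "idx (?A ! i) = i" if "i < ?k" for i
    unfolding idx_def using that distinct_cover_list[of G X]
    by (intro inv_into_f_f) (auto simp: inj_on_def nth_eq_iff_index_eq)
  have WA: "?W ! i = (L (?A ! i), [], [?A ! i])" if "i < ?k" for i
    using that by (simp add: kernel_vertices_def nth_append)
  have WB: "snd (snd (?W ! i)) = [] \<and> length (fst (snd (?W ! i))) \<le> c"
    if "\<not> i < ?k" "i < length ?W" for i
  proof -
    have "?W ! i \<in> set ?B"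
      using that by (simp add: kernel_vertices_def nth_append)
    then show ?thesis unfolding set_new_vertices[OF assms] by auto
  qed
  let ?E1 = "(\<lambda>(i, j). {i, j}) ` ({..<?k} \<times> {..<?k})"
  \<comment> \<open>An index \<open>m\<close> beyond the end of the sequence yields an arbitrary
    set; \<open>?E2\<close> only has to contain all mixed edges.\<close>
  let ?f = "\<lambda>(j, m). {j, idx (fst (snd (?W ! j)) ! m)}"
  let ?E2 = "?f ` ({?k..<length ?W} \<times> {..<c})"
  have mixed: "{i, j} \<in> ?E2" if ij: "i < ?k" "\<not> j < ?k" "j < length ?W" "kernel_adjacent G (?W ! i) (?W ! j)"
    for i j
  proof -
    have "?A ! i \<in> set (fst (snd (?W ! j)))"
      using ij(4) WB[OF ij(2,3)] unfolding kernel_adjacent_def WA[OF ij(1)] by simp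
    then obtain m where m: "m < length (fst (snd (?W ! j)))" "fst (snd (?W ! j)) ! m = ?A ! i"
      unfolding in_set_conv_nth by blast
    have f: "?f (j, m) = {i, j}"
      using idx[OF ij(1)] m(2) by (simp add: insert_commute)
    have "(j, m) \<in> {?k..<length ?W} \<times> {..<c}"
      using m(1) WB[OF ij(2,3)] ij(2,3) by simp
    then show ?thesis unfolding f[symmetric] by (rule imageI)
  qed
  have "edges (graph_of_list (kernel_adjacent G) ?W) \<subseteq> ?E1 \<union> ?E2"
  proof
    fix e assume "e \<in> edges (graph_of_list (kernel_adjacent G) ?W)"
    then obtain i j where ij: "e = {i, j}" "i < length ?W" "j < length ?W"
      "kernel_adjacent G (?W ! i) (?W ! j)"
      by (auto simp: graph_of_list_def)
    consider "i < ?k" "j < ?k" | "i < ?k" "\<not> j < ?k" | "\<not> i < ?k" "j < ?k" | "\<not> i < ?k" "\<not> j < ?k"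
      by blast
    then show "e \<in> ?E1 \<union> ?E2"
    proof cases
      case 1
      then show ?thesis using ij(1) by force
    next
      case 2
      then show ?thesis using mixed[OF _ _ ij(3,4)] ij(1) by blast
    next
      case 3
      have "{j, i} \<in> ?E2"
        using mixed[OF 3(2,1) ij(2)] ij(4) kernel_adjacent_commute[of G "?W ! i"] by blast
      then show ?thesis unfolding ij(1) insert_commute[of i] by (rule UnI2)
    next
      case 4
      have False
        using ij(4) WB[OF 4(1) ij(2)] WB[OF 4(2) ij(3)] unfolding kernel_adjacent_def by simp
      then show ?thesis ..
    qed
  qed
  then have "card (edges (graph_of_list (kernel_adjacent G) ?W)) \<le> card (?E1 \<union> ?E2)"
    by (intro card_mono) auto
  also have "\<dots> \<le> card ?E1 + card ?E2" by (rule card_Un_le)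
  also have "card ?E1 \<le> card ({..<?k} \<times> {..<?k})" by (intro card_image_le) auto
  also have "card ?E2 \<le> card ({?k..<length ?W} \<times> {..<c})" by (intro card_image_le) auto
  finally show ?thesis
    using length_cover_list[OF assms]
    by (simp add: kernel_vertices_def power2_eq_square)
qed


section \<open>Correctness of the kernel\<close>

lemma list_colorable_kernel:
  assumes H: "graph H" "set hs = verts H"
    and G: "graph G" "verts G = {..<n}" and L: "lists_for H G L" and X: "vertex_cover G X"
  defines "W \<equiv> kernel_vertices (c_star H) hs G L X"
  shows "list_colorable H (graph_of_list (kernel_adjacent G) W) (\<lambda>i. fst (W ! i)) \<longleftrightarrow>
    list_colorable H G L"
proof -
  let ?G = "graph_of_list (kernel_adjacent G) W" and ?L = "\<lambda>i. fst (W ! i)"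
  have adj: "adjacent ?G i j \<longleftrightarrow> i < length W \<and> j < length W \<and> kernel_adjacent G (W ! i) (W ! j)"
    for i j by (rule adjacent_graph_of_list[OF kernel_adjacent_commute])
  have finG: "finite (verts G)" using G(1) by (simp add: graph_def)
  have XG: "X \<subseteq> verts G" using X by (simp add: vertex_cover_def)
  have LH: "L v \<subseteq> verts H" if "v \<in> verts G" for v
    using L that by (simp add: lists_for_def)
  have set_W: "set W = (\<lambda>x. (L x, [], [x])) ` X \<union> {(L v, t, []) | v t. v \<in> verts G - X \<and>
      L v \<subseteq> set hs \<and> set t \<subseteq> X \<and> length t \<le> c_star H \<and> (\<forall>y\<in>set t. adjacent G v y)}"
    unfolding W_def kernel_vertices_def set_append set_new_vertices[OF G(2) XG] set_map
      set_cover_list[OF G(2) XG] ..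
  have 1: "list_colorable H ?G ?L" if colorable: "list_colorable H G L"
  proof -
    from colorable obtain \<phi> where \<phi>: "\<phi> ` verts G \<subseteq> verts H" "\<And>v. v \<in> verts G \<Longrightarrow> \<phi> v \<in> L v"
      "\<And>u v. u \<in> verts G \<Longrightarrow> v \<in> verts G \<Longrightarrow> adjacent G u v \<Longrightarrow> adjacent H (\<phi> u) (\<phi> v)"
      unfolding list_colorable_def list_hom_def by blast
    \<comment> \<open>Every descriptor is represented by a vertex of \<open>G\<close> with the same
      list and at least the required adjacencies, whose color it will copy. The last conjunct forces
      a cover vertex to represent itself and is vacuous for new vertices.\<close>
    have "\<forall>d\<in>set W. \<exists>v. v \<in> verts G \<and> L v = fst d \<and> (\<forall>y\<in>set (fst (snd d)). adjacent G v y) \<and>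
        set (snd (snd d)) \<subseteq> {v}"
      unfolding set_W using XG by fastforce
    then obtain r where r: "\<And>d. d \<in> set W \<Longrightarrow> r d \<in> verts G \<and> L (r d) = fst d \<and>
        (\<forall>y\<in>set (fst (snd d)). adjacent G (r d) y) \<and> set (snd (snd d)) \<subseteq> {r d}"
      by metis
    have "list_hom H ?G ?L (\<lambda>i. \<phi> (r (W ! i)))"
      unfolding list_hom_def verts_graph_of_list
    proof (intro conjI ballI impI)
      have rW: "r (W ! i) \<in> verts G" if "i < length W" for i
        using r that by simp
      show "(\<lambda>i. \<phi> (r (W ! i))) ` {..<length W} \<subseteq> verts H"
        using \<phi>(1) rW by blast
      show "\<phi> (r (W ! i)) \<in> fst (W ! i)" if "i \<in> {..<length W}" for i
        using \<phi>(2)[of "r (W ! i)"] rW[of i] r[of "W ! i"] that by force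
      show "adjacent H (\<phi> (r (W ! i))) (\<phi> (r (W ! j)))"
        if "i \<in> {..<length W}" "j \<in> {..<length W}" "adjacent ?G i j" for i j
      proof -
        have r_eq: "x = r (W ! m)" if "m < length W" "x \<in> set (snd (snd (W ! m)))" for x m
          using r[of "W ! m"] that by auto
        have r_adj: "adjacent G (r (W ! m)) y" if "m < length W" "y \<in> set (fst (snd (W ! m)))" for y m
          using r[of "W ! m"] that by auto
        have len: "i < length W" "j < length W" and "kernel_adjacent G (W ! i) (W ! j)"
          using that(3) unfolding adj by blast+
        then consider
            x y where "x \<in> set (snd (snd (W ! i)))" "y \<in> set (snd (snd (W ! j)))" "adjacent G x y"
          | x where "x \<in> set (snd (snd (W ! i)))" "x \<in> set (fst (snd (W ! j)))"
          | x where "x \<in> set (snd (snd (W ! j)))" "x \<in> set (fst (snd (W ! i)))"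
          unfolding kernel_adjacent_def by blast
        then have "adjacent G (r (W ! i)) (r (W ! j))"
        proof cases
          case 1
          then show ?thesis using r_eq len by blast
        next
          case 2
          have "adjacent G (r (W ! j)) (r (W ! i))"
            using r_eq[OF len(1) 2(1)] r_adj[OF len(2) 2(2)] by simp
          then show ?thesis by (rule adjacent_commute[THEN iffD1])
        next
          case 3
          then show ?thesis using r_eq[OF len(2) 3(1)] r_adj[OF len(1) 3(2)] by simp
        qed
        then show ?thesis using \<phi>(3) rW that by simp
      qed
    qed
    then show ?thesis unfolding list_colorable_def by blast
  qed
  have 2: "list_colorable H G L" if colorable: "list_colorable H ?G ?L"
  proof -
    from colorable obtain \<psi> where \<psi>: "\<And>i. i < length W \<Longrightarrow> \<psi> i \<in> fst (W ! i)"
      "\<And>i j. i < length W \<Longrightarrow> j < length W \<Longrightarrow> kernel_adjacent G (W ! i) (W ! j) \<Longrightarrow>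
        adjacent H (\<psi> i) (\<psi> j)"
      unfolding list_colorable_def list_hom_def adj verts_graph_of_list by (metis lessThan_iff)
    have "\<exists>i<length W. W ! i = (L x, [], [x])" if "x \<in> X" for x
    proof -
      have "(L x, [], [x]) \<in> set W" unfolding set_W using that by blast
      then show ?thesis unfolding in_set_conv_nth .
    qed
    then obtain idx where idx: "\<And>x. x \<in> X \<Longrightarrow> idx x < length W \<and> W ! idx x = (L x, [], [x])"
      by metis
    define \<chi> where "\<chi> x = \<psi> (idx x)" for x
    have \<chi>: "\<chi> x \<in> L x" if "x \<in> X" for x
      using \<psi>(1)[of "idx x"] idx[OF that] by (simp add: \<chi>_def)
    \<comment> \<open>Outside \<open>X\<close> there are neither edges nor loops, so once
      \<open>X\<close> is colored, the remaining vertices can be colored independently of each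
      other.\<close>
    have NX: "{y. adjacent G v y} \<subseteq> X" if "v \<in> verts G - X" for v
    proof
      fix y assume "y \<in> {y. adjacent G v y}"
      then have "{v, y} \<in> edges G" by (simp add: adjacent_def)
      then have "{v, y} \<inter> X \<noteq> {}" using X unfolding vertex_cover_def by (elim conjE bspec)
      then show "y \<in> X" using that by simp
    qed
    have "\<exists>a\<in>L v. \<forall>y. adjacent G v y \<longrightarrow> adjacent H a (\<chi> y)" if v: "v \<in> verts G - X" for v
    proof (rule ccontr)
      assume none: "\<not> ?thesis"
      let ?N = "{y. adjacent G v y}"
      have "\<not> has_common_neighbor H (L v) (\<chi> ` ?N)"
        using none unfolding has_common_neighbor_def by blast
      moreover have "\<chi> ` ?N \<subseteq> verts H"
        using NX[OF v] \<chi> LH XG by blast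
      moreover have "finite (\<chi> ` ?N)"
        using NX[OF v] XG finG by (meson finite_imageI finite_subset)
      ultimately obtain S where S: "S \<subseteq> \<chi> ` ?N" "minimal_obstruction H (L v) S"
        using minimal_obstruction_exists by metis
      \<comment> \<open>One neighbor is selected for each color of \<open>S\<close>, so
        \<open>U\<close> has exactly as many vertices as \<open>S\<close> has colors, and the bound
        \<open>c_star H\<close> applies to the sequence \<open>t\<close>.\<close>
      then obtain U where U: "U \<subseteq> ?N" "inj_on \<chi> U" "S = \<chi> ` U"
        by (meson subset_image_inj)
      have "finite U" using U(1) NX[OF v] XG finG by (meson finite_subset)
      then obtain t where t: "set t = U" "distinct t" using finite_distinct_list by blast
      have "length t = card S"
        using distinct_card[OF t(2)] card_image[OF U(2)] t(1) U(3) by simp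
      then have len: "length t \<le> c_star H"
        using card_minimal_obstruction_le[OF H(1) LH S(2)] v by simp
      have "(L v, t, []) \<in> set W"
      proof -
        have "L v \<subseteq> set hs" "set t \<subseteq> X" "\<forall>y\<in>set t. adjacent G v y"
          using v t(1) U(1) NX[OF v] LH[of v] H(2) by blast+
        then show ?thesis unfolding set_W using v len by blast
      qed
      then obtain j where j: "j < length W" "W ! j = (L v, t, [])"
        by (metis in_set_conv_nth)
      \<comment> \<open>The color of the new vertex for \<open>t\<close> lies in \<open>L v\<close>
        and is adjacent to the colors of all vertices in \<open>U\<close>, that is, to all of
        \<open>S\<close>: a common neighbor of an obstruction.\<close>
      have "adjacent H (\<psi> j) s" if s: "s \<in> S" for s
      proof -
        obtain y where y: "y \<in> U" "s = \<chi> y" using s U(3) by blast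
        then have "y \<in> X" using U(1) NX[OF v] by blast
        then show ?thesis
          using \<psi>(2)[of j "idx y"] j idx y t(1) by (simp add: kernel_adjacent_def \<chi>_def)
      qed
      moreover have "\<psi> j \<in> L v" using \<psi>(1)[OF j(1)] j(2) by simp
      ultimately show False
        using S(2) unfolding minimal_obstruction_def has_common_neighbor_def by blast
    qed
    then obtain a where a: "\<And>v. v \<in> verts G - X \<Longrightarrow> a v \<in> L v \<and> (\<forall>y. adjacent G v y \<longrightarrow> adjacent H (a v) (\<chi> y))"
      by metis
    define \<phi> where "\<phi> v = (if v \<in> X then \<chi> v else a v)" for v
    have \<phi>L: "\<phi> v \<in> L v" if "v \<in> verts G" for v
      using \<chi> a that by (simp add: \<phi>_def)
    have "adjacent H (\<phi> u) (\<phi> v)" if "u \<in> verts G" "v \<in> verts G" "adjacent G u v" for u v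
    proof -
      consider "u \<in> X" "v \<in> X" | "u \<notin> X" | "v \<notin> X" by blast
      then show ?thesis
      proof cases
        case 1
        then show ?thesis
          using \<psi>(2)[of "idx u" "idx v"] idx that(3) by (simp add: \<phi>_def \<chi>_def kernel_adjacent_def)
      next
        case 2
        then have "v \<in> X" using NX[of u] that by blast
        then show ?thesis using a[of u] 2 that by (simp add: \<phi>_def)
      next
        case 3
        then have "u \<in> X" using NX[of v] that adjacent_commute[of G u v] by blast
        then show ?thesis
          using a[of v] 3 that(2,3) adjacent_commute[of G u v] adjacent_commute[of H "\<phi> u" "\<phi> v"]
          unfolding \<phi>_def by simp
      qed
    qed
    moreover have "\<phi> ` verts G \<subseteq> verts H" using \<phi>L LH by blast
    ultimately show ?thesis
      using \<phi>L unfolding list_colorable_def list_hom_def by blast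
  qed
  from 1 2 show ?thesis by blast
qed

section \<open>Encodings\<close>

definition color_set_tree :: "'h list \<Rightarrow> 'h set \<Rightarrow> tree" where
  "color_set_tree hs A = tree_of_bits (map (\<lambda>a. a \<in> A) hs)"

definition tree_of_descriptor :: "'h list \<Rightarrow> 'h descriptor \<Rightarrow> tree" where
  "tree_of_descriptor hs d = Node (color_set_tree hs (fst d))
     (Node (tree_of_list (map tree_of_nat (fst (snd d))))
       (tree_of_list (map tree_of_nat (snd (snd d)))))"

lemma color_set_tree_eq_iff:
  assumes "A \<subseteq> set hs" "B \<subseteq> set hs"
  shows "color_set_tree hs A = color_set_tree hs B \<longleftrightarrow> A = B"
proof
  assume "color_set_tree hs A = color_set_tree hs B"
  then have "map (\<lambda>a. tree_of_bool (a \<in> A)) hs = map (\<lambda>a. tree_of_bool (a \<in> B)) hs"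
    by (simp add: color_set_tree_def tree_of_bits_def o_def)
  then have "\<forall>a\<in>set hs. a \<in> A \<longleftrightarrow> a \<in> B"
    by (simp add: map_eq_conv)
  then show "A = B" using assms by blast
qed simp

lemma map_conv_nth: "map f xs = map (\<lambda>i. f (xs ! i)) [0..<length xs]"
  by (rule nth_equalityI) auto

lemma encode_graph_of_list:
  assumes "\<And>d e. R d e \<longleftrightarrow> R e d"
  shows "encode_instance hs (graph_of_list R W) (\<lambda>i. l (W ! i)) =
    Node (tree_of_list (map (\<lambda>d. tree_of_list (map (\<lambda>e. tree_of_bool (R d e)) W)) W))
      (tree_of_list (map (\<lambda>d. color_set_tree hs (l d)) W))"
proof -
  have "map (\<lambda>u. tree_of_bits (map (adjacent (graph_of_list R W) u) [0..<length W])) [0..<length W] =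
      map (\<lambda>i. tree_of_list (map (\<lambda>j. tree_of_bool (R (W ! i) (W ! j))) [0..<length W])) [0..<length W]"
    by (auto simp: tree_of_bits_def adjacent_graph_of_list[OF assms] intro!: map_cong)
  then show ?thesis
    unfolding map_conv_nth[of _ W]
    by (simp add: encode_instance_def encode_graph_def encode_lists_def vertex_list_def
        color_set_tree_def)
qed

section \<open>Tree computations on an encoded graph\<close>

context
  fixes G :: "nat graph" and n :: nat
  assumes G: "verts G = {..<n}"
begin

lemma vertex_list_eq: "vertex_list G = [0..<n]"
  using G by (simp add: vertex_list_def)

lemma positions_encode_graph:
  "positions (list_of_tree (encode_graph G)) = map tree_of_nat (rev (vertex_list G))"
  by (simp add: positions_eq encode_graph_def vertex_list_eq)

lemma adjacent_tree_encode_graph: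
  assumes "u \<in> verts G" "v \<in> verts G"
  shows "adjacent_tree (encode_graph G) (tree_of_nat u) (tree_of_nat v) \<longleftrightarrow> adjacent G u v"
  using assms unfolding adjacent_tree_def encode_graph_def tree_of_bits_def
  by (simp add: G vertex_list_eq nth_tree_of_nat)

lemma nth_tree_encode_lists:
  assumes "v \<in> verts G"
  shows "nth_tree (encode_lists hs G L) (tree_of_nat v) = color_set_tree hs (L v)"
  using assms unfolding encode_lists_def color_set_tree_def
  by (simp add: G vertex_list_eq nth_tree_of_nat)

lemma nth_tree_encode_cover:
  assumes "v \<in> verts G"
  shows "nth_tree (tree_of_bits (map (\<lambda>v. v \<in> X) (vertex_list G))) (tree_of_nat v) = tree_of_bool (v \<in> X)"
  using assms unfolding tree_of_bits_def
  by (simp add: G vertex_list_eq nth_tree_of_nat)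

lemma kernel_adjacent_tree_eq:
  assumes "set (fst (snd d)) \<union> set (snd (snd d)) \<subseteq> verts G" "set (fst (snd e)) \<union> set (snd (snd e)) \<subseteq> verts G"
  shows "kernel_adjacent_tree (encode_graph G) (tree_of_descriptor hs d) (tree_of_descriptor hs e)
    \<longleftrightarrow> kernel_adjacent G d e"
proof -
  have "(\<exists>x\<in>set (snd (snd d)). \<exists>y\<in>set (snd (snd e)).
        adjacent_tree (encode_graph G) (tree_of_nat x) (tree_of_nat y)) \<longleftrightarrow>
      (\<exists>x\<in>set (snd (snd d)). \<exists>y\<in>set (snd (snd e)). adjacent G x y)"
    using assms by (intro bex_cong refl adjacent_tree_encode_graph) auto
  then show ?thesis
    by (simp add: kernel_adjacent_tree_def kernel_adjacent_def tree_of_descriptor_def image_iff)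
qed

text \<open>Equality of sets would not do: positions in the list become the vertices of the kernel,
  so order and multiplicity must agree as well.\<close>

lemma kernel_vertex_trees_eq:
  assumes L: "\<And>v. v \<in> verts G \<Longrightarrow> L v \<subseteq> set hs" and X: "X \<subseteq> verts G"
  shows "kernel_vertex_trees c (map (color_set_tree hs) (map set (subseqs hs))) (encode_graph G)
      (encode_lists hs G L) (tree_of_bits (map (\<lambda>v. v \<in> X) (vertex_list G))) =
    map (tree_of_descriptor hs) (kernel_vertices c hs G L X)"
proof -
  let ?M = "encode_graph G" and ?xb = "tree_of_bits (map (\<lambda>v. v \<in> X) (vertex_list G))"
  let ?V = "rev (vertex_list G)"
  have V: "set ?V = verts G" using set_vertex_list[OF G] by simp
  have cover: "filter (\<lambda>v. nth_tree ?xb v \<noteq> Leaf) (positions (list_of_tree ?M)) =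
      map tree_of_nat (cover_list G X)"
  proof -
    have "filter (\<lambda>v. nth_tree ?xb (tree_of_nat v) \<noteq> Leaf) ?V = filter (\<lambda>v. v \<in> X) ?V"
      by (intro filter_cong refl) (use V nth_tree_encode_cover in simp)
    then show ?thesis
      unfolding positions_encode_graph filter_map o_def cover_list_def by (rule arg_cong)
  qed
  define D where "D = concat (map (\<lambda>t. map (\<lambda>l. (l, t, [] :: nat list)) (map set (subseqs hs)))
    (lists_upto c (cover_list G X)))"
  have D: "fst d \<subseteq> set hs \<and> set (fst (snd d)) \<subseteq> verts G" if "d \<in> set D" for d
  proof -
    obtain t l where "d = (l, t, [])" "l \<in> set ` set (subseqs hs)" "t \<in> set (lists_upto c (cover_list G X))"
      using \<open>d \<in> set D\<close> unfolding D_def by auto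
    then show ?thesis
      using X unfolding subseqs_powset set_lists_upto set_cover_list[OF G X] by auto
  qed
  have trees: "concat (map (\<lambda>t. map (\<lambda>l. Node l (Node t Leaf)) (map (color_set_tree hs) (map set (subseqs hs))))
      (list_trees_upto c (map tree_of_nat (cover_list G X)))) = map (tree_of_descriptor hs) D"
    unfolding D_def
    by (simp add: list_trees_upto_eq lists_upto_map map_concat o_def tree_of_descriptor_def)
  let ?P = "\<lambda>d. \<exists>v\<in>set (map tree_of_nat ?V). nth_tree ?xb v = Leaf \<and>
    nth_tree (encode_lists hs G L) v = hd_tree d \<and>
    (\<forall>y\<in>set (list_of_tree (hd_tree (tl_tree d))). adjacent_tree ?M v y)"
  let ?Q = "\<lambda>d. \<exists>v\<in>set ?V. v \<notin> X \<and> L v = fst d \<and> (\<forall>y\<in>set (fst (snd d)). adjacent G v y)"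
  have PQ: "?P (tree_of_descriptor hs d) \<longleftrightarrow> ?Q d" if "d \<in> set D" for d
  proof -
    have "?P (tree_of_descriptor hs d) \<longleftrightarrow> (\<exists>v\<in>verts G. nth_tree ?xb (tree_of_nat v) = Leaf \<and>
        nth_tree (encode_lists hs G L) (tree_of_nat v) = color_set_tree hs (fst d) \<and>
        (\<forall>y\<in>set (fst (snd d)). adjacent_tree ?M (tree_of_nat v) (tree_of_nat y)))"
      unfolding set_map V by (simp add: tree_of_descriptor_def)
    also have "\<dots> \<longleftrightarrow> (\<exists>v\<in>verts G. v \<notin> X \<and> L v = fst d \<and> (\<forall>y\<in>set (fst (snd d)). adjacent G v y))"
    proof (intro bex_cong refl)
      fix v assume v: "v \<in> verts G"
      have "nth_tree ?xb (tree_of_nat v) = Leaf \<longleftrightarrow> v \<notin> X"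
        using nth_tree_encode_cover[OF v] by simp
      \<comment> \<open>The program compares codes of lists; codes are injective on subsets of
        \<open>set hs\<close>, and both sides are such subsets.\<close>
      moreover have "nth_tree (encode_lists hs G L) (tree_of_nat v) = color_set_tree hs (fst d) \<longleftrightarrow>
          L v = fst d"
        unfolding nth_tree_encode_lists[OF v] using color_set_tree_eq_iff L[OF v] D[OF that] by blast
      moreover have "(\<forall>y\<in>set (fst (snd d)). adjacent_tree ?M (tree_of_nat v) (tree_of_nat y)) \<longleftrightarrow>
          (\<forall>y\<in>set (fst (snd d)). adjacent G v y)"
        using D[OF that] by (intro ball_cong refl adjacent_tree_encode_graph v) blast
      ultimately show "(nth_tree ?xb (tree_of_nat v) = Leaf \<and>
          nth_tree (encode_lists hs G L) (tree_of_nat v) = color_set_tree hs (fst d) \<and>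
          (\<forall>y\<in>set (fst (snd d)). adjacent_tree ?M (tree_of_nat v) (tree_of_nat y))) \<longleftrightarrow>
          (v \<notin> X \<and> L v = fst d \<and> (\<forall>y\<in>set (fst (snd d)). adjacent G v y))"
        by blast
    qed
    finally show ?thesis unfolding V .
  qed
  have "map (\<lambda>v. Node (nth_tree (encode_lists hs G L) v) (Node Leaf (Node v Leaf)))
        (map tree_of_nat (cover_list G X)) =
      map (tree_of_descriptor hs) (map (\<lambda>v. (L v, [], [v])) (cover_list G X))"
    unfolding map_map o_def
    using X set_cover_list[OF G X]
    by (intro map_cong refl) (auto simp: tree_of_descriptor_def nth_tree_encode_lists)
  moreover have "filter ?P (map (tree_of_descriptor hs) D) =
      map (tree_of_descriptor hs) (new_vertices c hs G L X)"
  proof -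
    have "filter (?P \<circ> tree_of_descriptor hs) D = filter ?Q D"
      using PQ by (intro filter_cong refl) (simp only: o_apply)
    then show ?thesis unfolding filter_map new_vertices_def D_def[symmetric] by (rule arg_cong)
  qed
  ultimately show ?thesis
    unfolding kernel_vertex_trees_def cover trees kernel_vertices_def map_append
    unfolding positions_encode_graph by (simp only:)
qed

lemma kernel_tree_eq:
  fixes c :: nat
  assumes L: "\<And>v. v \<in> verts G \<Longrightarrow> L v \<subseteq> set hs" and X: "X \<subseteq> verts G"
  defines "W \<equiv> kernel_vertices c hs G L X"
  shows "kernel_tree c (map (color_set_tree hs) (map set (subseqs hs))) (encode_vc_instance hs G L X) =
    encode_instance hs (graph_of_list (kernel_adjacent G) W) (\<lambda>i. fst (W ! i))"
proof -
  have W: "set (fst (snd d)) \<union> set (snd (snd d)) \<subseteq> verts G" if "d \<in> set W" for d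
    using that X
    unfolding W_def kernel_vertices_def set_append set_map set_cover_list[OF G X] set_new_vertices[OF G X]
    by auto
  have "kernel_tree c (map (color_set_tree hs) (map set (subseqs hs))) (encode_vc_instance hs G L X) =
      graph_tree_of_list (kernel_adjacent_tree (encode_graph G)) (map (tree_of_descriptor hs) W)"
    using kernel_vertex_trees_eq[OF L X]
    by (simp add: kernel_tree_def encode_vc_instance_def encode_instance_def W_def)
  also have "\<dots> = Node (tree_of_list (map (\<lambda>d. tree_of_list (map (\<lambda>e. tree_of_bool (kernel_adjacent G d e)) W)) W))
      (tree_of_list (map (\<lambda>d. color_set_tree hs (fst d)) W))"
  proof -
    have "map (\<lambda>d. tree_of_list (map (\<lambda>e. tree_of_bool (kernel_adjacent_tree (encode_graph G)
          (tree_of_descriptor hs d) (tree_of_descriptor hs e))) W)) W =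
        map (\<lambda>d. tree_of_list (map (\<lambda>e. tree_of_bool (kernel_adjacent G d e)) W)) W"
      by (intro map_cong refl arg_cong[where f = tree_of_list] arg_cong[where f = tree_of_bool]
          kernel_adjacent_tree_eq W)
    then show ?thesis
      by (simp add: graph_tree_of_list_def o_def tree_of_descriptor_def)
  qed
  also have "\<dots> = encode_instance hs (graph_of_list (kernel_adjacent G) W) (\<lambda>i. fst (W ! i))"
    by (rule encode_graph_of_list[OF kernel_adjacent_commute, symmetric])
  finally show ?thesis .
qed

definition bad_pairs :: "'h graph \<Rightarrow> 'h list \<Rightarrow> tree list" where
  "bad_pairs H hs = map (\<lambda>(A, B). Node (color_set_tree hs A) (color_set_tree hs B))
     (filter (\<lambda>(A, B). \<forall>a\<in>A. \<forall>b\<in>B. \<not> adjacent H a b)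
       (List.product (map set (subseqs hs)) (map set (subseqs hs))))"

lemma locally_bad_tree_eq:
  assumes L: "\<And>v. v \<in> verts G \<Longrightarrow> L v \<subseteq> set hs"
  shows "locally_bad_tree (color_set_tree hs {}) (bad_pairs H hs) (encode_vc_instance hs G L X) \<longleftrightarrow>
    locally_bad H G L"
proof -
  \<comment> \<open>A table lookup by code decides the property of the sets themselves, again
    because codes determine subsets of \<open>set hs\<close>.\<close>
  have pair: "(\<exists>p\<in>set (bad_pairs H hs). p = Node (color_set_tree hs A) (color_set_tree hs B)) \<longleftrightarrow>
      (\<forall>a\<in>A. \<forall>b\<in>B. \<not> adjacent H a b)" if AB: "A \<subseteq> set hs" "B \<subseteq> set hs" for A B
  proof -
    have bad: "set (bad_pairs H hs) = {Node (color_set_tree hs A) (color_set_tree hs B) | A B.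
        A \<subseteq> set hs \<and> B \<subseteq> set hs \<and> (\<forall>a\<in>A. \<forall>b\<in>B. \<not> adjacent H a b)}"
      unfolding bad_pairs_def set_map set_filter set_product subseqs_powset by auto
    have "(\<exists>p\<in>set (bad_pairs H hs). p = Node (color_set_tree hs A) (color_set_tree hs B)) \<longleftrightarrow>
        (\<exists>A' B'. A' \<subseteq> set hs \<and> B' \<subseteq> set hs \<and> (\<forall>a\<in>A'. \<forall>b\<in>B'. \<not> adjacent H a b) \<and>
          color_set_tree hs A' = color_set_tree hs A \<and> color_set_tree hs B' = color_set_tree hs B)"
      unfolding bad by (simp only: bex_simps mem_Collect_eq) (metis tree.inject)
    also have "\<dots> \<longleftrightarrow> (\<forall>a\<in>A. \<forall>b\<in>B. \<not> adjacent H a b)"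
      using AB color_set_tree_eq_iff[OF _ AB(1)] color_set_tree_eq_iff[OF _ AB(2)] by metis
    finally show ?thesis .
  qed
  have V: "set (rev (vertex_list G)) = verts G" using set_vertex_list[OF G] by simp
  have "locally_bad_tree (color_set_tree hs {}) (bad_pairs H hs) (encode_vc_instance hs G L X) \<longleftrightarrow>
      (\<exists>u\<in>verts G. nth_tree (encode_lists hs G L) (tree_of_nat u) = color_set_tree hs {} \<or>
       (\<exists>v\<in>verts G. adjacent_tree (encode_graph G) (tree_of_nat u) (tree_of_nat v) \<and>
         (\<exists>p\<in>set (bad_pairs H hs). p = Node (nth_tree (encode_lists hs G L) (tree_of_nat u))
            (nth_tree (encode_lists hs G L) (tree_of_nat v)))))"
    unfolding locally_bad_tree_def encode_vc_instance_def encode_instance_def hd_tree.simps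
      tl_tree.simps positions_encode_graph set_map V bex_simps ..
  also have "\<dots> \<longleftrightarrow> locally_bad H G L"
    unfolding locally_bad_def
  proof (intro bex_cong refl disj_cong conj_cong)
    fix u assume u: "u \<in> verts G"
    show "nth_tree (encode_lists hs G L) (tree_of_nat u) = color_set_tree hs {} \<longleftrightarrow> L u = {}"
      unfolding nth_tree_encode_lists[OF u] by (rule color_set_tree_eq_iff) (use L[OF u] in auto)
    fix v assume v: "v \<in> verts G"
    show "adjacent_tree (encode_graph G) (tree_of_nat u) (tree_of_nat v) \<longleftrightarrow> adjacent G u v"
      by (rule adjacent_tree_encode_graph[OF u v])
    show "(\<exists>p\<in>set (bad_pairs H hs). p = Node (nth_tree (encode_lists hs G L) (tree_of_nat u))
        (nth_tree (encode_lists hs G L) (tree_of_nat v))) \<longleftrightarrow>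
      (\<forall>a\<in>L u. \<forall>b\<in>L v. \<not> adjacent H a b)"
      unfolding nth_tree_encode_lists[OF u] nth_tree_encode_lists[OF v] by (rule pair[OF L[OF u] L[OF v]])
  qed
  finally show ?thesis .
qed

end

section \<open>The constant kernel and the general kernel\<close>

definition edgeless_graph :: "nat \<Rightarrow> nat graph" where
  "edgeless_graph n = \<lparr>verts = {..<n}, edges = {}\<rparr>"

lemma edgeless_instance: "list_coloring_instance H (edgeless_graph n) (\<lambda>_. {})"
  by (auto simp: list_coloring_instance_def edgeless_graph_def graph_def lists_for_def)

text \<open>A vertex with an empty list cannot be colored, so \<open>n = 1\<close> provides a fixed
  no-instance and \<open>n = 0\<close> a fixed yes-instance.\<close>

lemma list_colorable_edgeless: "list_colorable H (edgeless_graph n) (\<lambda>_. {}) \<longleftrightarrow> n = 0"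
  by (auto simp: list_colorable_def list_hom_def edgeless_graph_def)

lemma kernelization_trivial:
  assumes H: "graph H" "set hs = verts H" "c_star H \<le> 1"
  shows "\<exists>K. kernelization H hs (\<lambda>_. 1) K"
proof -
  let ?I = "\<lambda>n. encode_instance hs (edgeless_graph n) (\<lambda>_. {})"
  let ?K = "\<lambda>z. if locally_bad_tree (color_set_tree hs {}) (bad_pairs H hs) z then ?I 1 else ?I 0"
  have "poly_time ?K"
    by (intro poly_time_if poly_time_locally_bad_tree poly_time_const)
  moreover have "\<exists>G' L'. list_coloring_instance H G' L' \<and> ?K (encode_vc_instance hs G L X) = encode_instance hs G' L' \<and>
      (list_colorable H G' L' \<longleftrightarrow> list_colorable H G L) \<and> card (verts G') \<le> 1 \<and> card (edges G') \<le> 1"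
    if "list_coloring_instance H G L" for G L X
  proof -
    obtain n where G: "verts G = {..<n}" and L: "lists_for H G L"
      using \<open>list_coloring_instance H G L\<close> unfolding list_coloring_instance_def by blast
    let ?m = "if locally_bad H G L then 1 else 0"
    have "locally_bad_tree (color_set_tree hs {}) (bad_pairs H hs) (encode_vc_instance hs G L X) \<longleftrightarrow>
        locally_bad H G L"
      using L H(2) by (intro locally_bad_tree_eq[OF G]) (simp add: lists_for_def)
    then have "?K (encode_vc_instance hs G L X) = ?I ?m" by simp
    moreover have "list_colorable H (edgeless_graph ?m) (\<lambda>_. {}) \<longleftrightarrow> list_colorable H G L"
      unfolding list_colorable_edgeless list_colorable_iff_not_locally_bad[OF H(1,3) L] by simp
    moreover have "card (verts (edgeless_graph ?m)) \<le> 1 \<and> card (edges (edgeless_graph ?m)) \<le> 1"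
      by (simp add: edgeless_graph_def)
    ultimately show ?thesis using edgeless_instance[of H ?m] by blast
  qed
  ultimately show ?thesis
    unfolding kernelization_def using poly_time_imp_polynomial_time_on by blast
qed

text \<open>A common bound for vertices and edges: \<open>k\<close> cover vertices,
  \<open>k ^ 2\<close> edges among them, and for each of the \<open>2 ^ h * (k + 1) ^ c\<close>
  possible new vertices the vertex itself and its \<open>c\<close> edges.\<close>

definition kernel_size :: "nat \<Rightarrow> nat \<Rightarrow> nat \<Rightarrow> nat" where
  "kernel_size h c k = k + k ^ 2 + 2 ^ h * (k + 1) ^ c * (c + 1)"

lemma kernelization_general:
  assumes H: "graph H" "distinct hs" "set hs = verts H"
  shows "\<exists>K. kernelization H hs (kernel_size (card (verts H)) (c_star H)) K"
proof -
  let ?c = "c_star H" and ?h = "card (verts H)"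
  let ?K = "kernel_tree ?c (map (color_set_tree hs) (map set (subseqs hs)))"
  have h: "length hs = ?h" using H(2,3) distinct_card by metis
  have "\<exists>G' L'. list_coloring_instance H G' L' \<and> ?K (encode_vc_instance hs G L X) = encode_instance hs G' L' \<and>
      (list_colorable H G' L' \<longleftrightarrow> list_colorable H G L) \<and>
      card (verts G') \<le> kernel_size ?h ?c (card X) \<and> card (edges G') \<le> kernel_size ?h ?c (card X)"
    if inst: "list_coloring_instance H G L" and X: "vertex_cover G X" for G L X
  proof -
    obtain n where G: "graph G" "verts G = {..<n}" and L: "lists_for H G L"
      using inst unfolding list_coloring_instance_def by blast
    have XG: "X \<subseteq> verts G" using X by (simp add: vertex_cover_def)
    have LH: "L v \<subseteq> set hs" if "v \<in> verts G" for v
      using L that H(3) by (simp add: lists_for_def)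
    define W where "W = kernel_vertices ?c hs G L X"
    let ?G = "graph_of_list (kernel_adjacent G) W" and ?L = "\<lambda>i. fst (W ! i)"
    let ?B = "new_vertices ?c hs G L X"
    have "L v \<subseteq> set hs" if "v \<in> X" for v
      using that LH XG by blast
    then have "fst d \<subseteq> verts H" if "d \<in> set W" for d
      using that
      unfolding W_def kernel_vertices_def set_append set_map set_cover_list[OF G(2) XG]
        set_new_vertices[OF G(2) XG] H(3)[symmetric]
      by fastforce
    then have "list_coloring_instance H ?G ?L"
      by (simp add: list_coloring_instance_def graph_graph_of_list lists_for_def)
    moreover have "?K (encode_vc_instance hs G L X) = encode_instance hs ?G ?L"
      unfolding W_def by (rule kernel_tree_eq[OF G(2) LH XG])
    moreover have "list_colorable H ?G ?L \<longleftrightarrow> list_colorable H G L"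
      unfolding W_def by (rule list_colorable_kernel[OF H(1,3) G L X])
    moreover have B: "length ?B \<le> 2 ^ ?h * (card X + 1) ^ ?c"
      using length_new_vertices[OF G(2) XG] h by metis
    have "card (verts ?G) \<le> kernel_size ?h ?c (card X)"
      using B length_cover_list[OF G(2) XG]
      by (simp add: W_def kernel_vertices_def kernel_size_def)
    moreover have "card (edges ?G) \<le> kernel_size ?h ?c (card X)"
    proof -
      have "card (edges ?G) \<le> card X ^ 2 + length ?B * ?c"
        unfolding W_def by (rule card_edges_kernel[OF G(2) XG])
      also have "\<dots> \<le> card X ^ 2 + 2 ^ ?h * (card X + 1) ^ ?c * ?c"
        using B by (intro add_left_mono mult_le_mono1)
      also have "\<dots> \<le> kernel_size ?h ?c (card X)"
        by (simp add: kernel_size_def)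
      finally show ?thesis .
    qed
    ultimately show ?thesis by blast
  qed
  then show ?thesis
    unfolding kernelization_def
    using poly_time_imp_polynomial_time_on[OF poly_time_kernel_tree] by blast
qed

text \<open>The assumption on \<open>c\<close> absorbs the term \<open>k ^ 2\<close> for edges
  inside the cover. For \<open>1 \<le> k\<close>, replacing \<open>k + 1\<close> by
  \<open>2 * k\<close> accounts for the factor \<open>2 ^ c\<close>, and the summand 2 collects
  \<open>k\<close> and \<open>k ^ 2\<close>.\<close>

lemma kernel_size_bigo:
  assumes "2 \<le> c"
  shows "(\<lambda>k. real (kernel_size h c k)) \<in> O(\<lambda>k. real k ^ c)"
proof (rule bigoI)
  have "real (kernel_size h c k) \<le> real (2 + 2 ^ h * 2 ^ c * (c + 1)) * real k ^ c" if "1 \<le> k" for k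
  proof -
    have "(k + 1) ^ c \<le> (2 * k) ^ c" using that by (intro power_mono) auto
    then have "2 ^ h * (k + 1) ^ c * (c + 1) \<le> 2 ^ h * (2 ^ c * k ^ c) * (c + 1)"
      by (intro mult_le_mono le_refl) (simp add: power_mult_distrib)
    moreover have "k ^ 1 \<le> k ^ c" "k ^ 2 \<le> k ^ c"
      using that assms by (intro power_increasing; simp)+
    ultimately have "kernel_size h c k \<le> k ^ c + k ^ c + 2 ^ h * (2 ^ c * k ^ c) * (c + 1)"
      unfolding kernel_size_def by (intro add_mono) auto
    also have "\<dots> = (2 + 2 ^ h * 2 ^ c * (c + 1)) * k ^ c"
      by (simp add: algebra_simps)
    finally show ?thesis by (metis of_nat_le_iff of_nat_mult of_nat_power)
  qed
  then show "\<forall>\<^sub>F k in at_top. norm (real (kernel_size h c k)) \<le>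
      real (2 + 2 ^ h * 2 ^ c * (c + 1)) * norm (real k ^ c)"
    by (intro eventually_at_top_linorderI[of 1]) simp
qed

theorem theorem3:
  fixes H :: "'h graph"
  assumes "graph H"
  shows "\<exists>f :: nat \<Rightarrow> nat.
    (\<lambda>k. real (f k)) \<in> O(\<lambda>k. real k ^ c_star H) \<and> admits_kernel H f"
proof (cases "c_star H \<le> 1")
  case True
  \<comment> \<open>The estimate starts at \<open>k = 1\<close>, since \<open>k ^ c_star H\<close>
    vanishes at \<open>k = 0\<close> when \<open>c_star H = 1\<close>.\<close>
  have "(\<lambda>k. real 1) \<in> O(\<lambda>k. real k ^ c_star H)"
    by (intro bigoI[of _ 1] eventually_at_top_linorderI[of 1]) (simp add: one_le_power)
  then show ?thesis
    using kernelization_trivial[OF assms _ True] unfolding admits_kernel_def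
    by (intro exI[of _ "\<lambda>_. 1"]) simp
next
  case False
  then show ?thesis
    using kernel_size_bigo[of "c_star H"] kernelization_general[OF assms]
    unfolding admits_kernel_def by (intro exI[of _ "kernel_size (card (verts H)) (c_star H)"]) simp
qed

end
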